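(* There is a universal constant $K$ such that, if $p = p(n) \ge K/\sqrt{n}$, then \[ \Pr\big(G_{n,p} \text{ contains the square of a Hamilton cycle}\big) \to 1 \quad \text{as } n \to \infty. \]
   Context: $G_{n,p}$ is the binomial random graph on vertex set $\{1,\dots,n\}$ in which each of the $\binom n2$ possible edges is present independently with probability $p$. The square of a graph $G$ is the graph on $V(G)$ in which two vertices are adjacent iff their distance in $G$ is at most $2$; the square of a Hamilton cycle of $K_n$ is the square of an $n$-vertex cycle on the vertex set of $K_n$. "$G_{n,p}$ contains the square of a Hamilton cycle" means some such graph is a subgraph of $G_{n,p}$. *)

theory Defs
  imports "HOL-Probability.Probability" "HOL-Probability.Product_PMF" "HOL-Library.Extended_Nat"
begin

text \<open>Simple graphs are given by a vertex set \<open>V\<close> and a set of edges \<open>E \<subseteq> complete_edges V\<close>.\<close>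

definition complete_edges :: "'a set \<Rightarrow> 'a set set" where
  "complete_edges V = {e. e \<subseteq> V \<and> card e = 2}"

definition binomial_random_graph :: "nat \<Rightarrow> real \<Rightarrow> nat set set pmf" where
  "binomial_random_graph n p =
     map_pmf (\<lambda>X. {e \<in> complete_edges {1..n}. X e})
       (Pi_pmf (complete_edges {1..n}) False (\<lambda>_. bernoulli_pmf p))"

definition walk_between :: "'a set set \<Rightarrow> 'a \<Rightarrow> 'a list \<Rightarrow> 'a \<Rightarrow> bool" where
  "walk_between E u xs v \<longleftrightarrow>
     xs \<noteq> [] \<and> hd xs = u \<and> last xs = v \<and> successively (\<lambda>x y. {x, y} \<in> E) xs"

text \<open>The distance is \<open>\<infinity>\<close> if there is no walk, as then the infimum is over the empty set.\<close>

definition graph_dist :: "'a set set \<Rightarrow> 'a \<Rightarrow> 'a \<Rightarrow> enat" where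
  "graph_dist E u v = Inf {enat (length xs - 1) | xs. walk_between E u xs v}"

definition graph_square :: "'a set \<Rightarrow> 'a set set \<Rightarrow> 'a set set" where
  "graph_square V E = {{u, v} | u v. u \<in> V \<and> v \<in> V \<and> u \<noteq> v \<and> graph_dist E u v \<le> 2}"

definition hamilton_cycle :: "'a set \<Rightarrow> 'a set set \<Rightarrow> bool" where
  "hamilton_cycle V C \<longleftrightarrow>
     (\<exists>vs. distinct vs \<and> set vs = V \<and> length vs \<ge> 3 \<and>
           C = {{vs ! i, vs ! ((i + 1) mod length vs)} | i. i < length vs})"

definition contains_square_hamilton_cycle :: "'a set \<Rightarrow> 'a set set \<Rightarrow> bool" where
  "contains_square_hamilton_cycle V E \<longleftrightarrow>
     (\<exists>C. hamilton_cycle V C \<and> graph_square V C \<subseteq> E)"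

end

theory Submission
  imports Defs "HOL-Real_Asymp.Real_Asymp"
begin

text \<open>
  The proof reveals the random graph in three independent rounds of density \<open>C / sqrt n\<close> each and
  keeps, for most squares \<open>S\<close> of Hamilton cycles, a fragment of \<open>S\<close> such that the fragment together
  with the edges revealed so far contains the square of a (possibly different) Hamilton cycle.
  Replacing the fragments by the smallest ones available after a round \<open>W\<close>, a fragment \<open>T\<close> which
  is still large is contained in a set \<open>J\<close> that depends on \<open>W \<union> T\<close> only. Hence the expected number
  of large fragments is at most the maximum over \<open>J\<close> of the sum of \<open>p ^ (- |T|)\<close> times the number
  of squares containing \<open>T\<close>, over all large \<open>T \<subseteq> J\<close>.

  If \<open>T\<close> has \<open>t\<close> edges and \<open>s\<close> components, only a proportion of about \<open>n powr (- (t + s) / 2)\<close> of all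
  squares contains \<open>T\<close>, so each component contributes a factor \<open>1 / sqrt n\<close>. It follows that the first
  round reduces the size of the fragments to \<open>O(sqrt n)\<close>, the second one to \<open>n powr (1 / 4)\<close>, and the third
  one to zero.
\<close>

section \<open>Random subsets\<close>

text \<open>Kept as a finite sum rather than an integral, because the double counting in
  \<open>fragment_cover_step\<close> compares the weights of single subsets.\<close>

definition subset_expectation :: "'a set \<Rightarrow> real \<Rightarrow> ('a set \<Rightarrow> real) \<Rightarrow> real" where
  "subset_expectation M p h = (\<Sum>W\<in>Pow M. p ^ card W * (1 - p) ^ card (M - W) * h W)"

lemma subset_expectation_empty [simp]: "subset_expectation {} p h = h {}"
  by (simp add: subset_expectation_def)

lemma subset_expectation_add:
  "subset_expectation M p (\<lambda>W. g W + h W) = subset_expectation M p g + subset_expectation M p h"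
  by (simp add: subset_expectation_def algebra_simps sum.distrib)

lemma subset_expectation_cmult:
  "subset_expectation M p (\<lambda>W. c * h W) = c * subset_expectation M p h"
  by (simp add: subset_expectation_def algebra_simps sum_distrib_left)

lemma subset_expectation_mono:
  assumes "0 \<le> p" "p \<le> 1" "\<And>W. W \<subseteq> M \<Longrightarrow> g W \<le> h W"
  shows "subset_expectation M p g \<le> subset_expectation M p h"
  unfolding subset_expectation_def using assms by (intro sum_mono mult_left_mono) auto

lemma subset_expectation_insert:
  assumes "finite M" "e \<notin> M"
  shows "subset_expectation (insert e M) p h =
    (1 - p) * subset_expectation M p h + p * subset_expectation M p (\<lambda>W. h (insert e W))"
proof -
  have inj: "inj_on (insert e) (Pow M)"
    using assms(2) by (auto simp: inj_on_def)
  have disj: "Pow M \<inter> insert e ` Pow M = {}"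
    using assms(2) by auto
  have 1: "p ^ card W * (1 - p) ^ card (insert e M - W) * h W
      = (1 - p) * (p ^ card W * (1 - p) ^ card (M - W) * h W)" if "W \<in> Pow M" for W
  proof -
    have "insert e M - W = insert e (M - W)" "e \<notin> M - W" "finite (M - W)"
      using that assms by auto
    then show ?thesis by simp
  qed
  have 2: "p ^ card (insert e W) * (1 - p) ^ card (insert e M - insert e W) * h (insert e W)
      = p * (p ^ card W * (1 - p) ^ card (M - W) * h (insert e W))" if "W \<in> Pow M" for W
  proof -
    have "insert e M - insert e W = M - W" "e \<notin> W" "finite W"
      using that assms by (auto intro: finite_subset)
    then show ?thesis by simp
  qed
  have "subset_expectation (insert e M) p h =
      (\<Sum>W\<in>Pow M. p ^ card W * (1 - p) ^ card (insert e M - W) * h W) +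
      (\<Sum>W\<in>Pow M. p ^ card (insert e W) * (1 - p) ^ card (insert e M - insert e W) * h (insert e W))"
    unfolding subset_expectation_def Pow_insert
    using assms(1) disj by (simp add: sum.union_disjoint sum.reindex[OF inj] o_def)
  also have "\<dots> = (1 - p) * subset_expectation M p h + p * subset_expectation M p (\<lambda>W. h (insert e W))"
    unfolding subset_expectation_def sum_distrib_left
    by (intro arg_cong2[where f = "(+)"] sum.cong refl 1 2)
  finally show ?thesis .
qed

lemma subset_expectation_const:
  assumes "finite M"
  shows "subset_expectation M p (\<lambda>_. c) = c"
  using assms by induction (auto simp: subset_expectation_insert algebra_simps)

text \<open>The union of two independent random subsets misses an element with probability
  \<open>(1 - p) * (1 - q)\<close>. This is what allows the random graph to be revealed in
  rounds.\<close>

lemma subset_expectation_union: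
  assumes "finite M"
  shows "subset_expectation M (p + q - p * q) h =
    subset_expectation M p (\<lambda>W. subset_expectation M q (\<lambda>W'. h (W \<union> W')))"
  using assms
proof (induction M arbitrary: h)
  case empty
  then show ?case by simp
next
  case (insert e M)
  note [simp] = subset_expectation_add subset_expectation_cmult
  show ?case
    using insert.hyps
    by (simp add: subset_expectation_insert insert.IH) (simp add: algebra_simps)
qed

section \<open>The binomial random graph as a random set of edges\<close>

lemma prob_bind_bernoulli_pmf:
  assumes "0 \<le> p" "p \<le> 1"
  shows "measure_pmf.prob (bernoulli_pmf p \<bind> F) B =
    p * measure_pmf.prob (F True) B + (1 - p) * measure_pmf.prob (F False) B"
proof -
  have "ennreal (measure_pmf.prob (bernoulli_pmf p \<bind> F) B) =
      ennreal (measure_pmf.prob (F True) B) * ennreal p +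
      ennreal (measure_pmf.prob (F False) B) * ennreal (1 - p)"
    using assms by (simp add: measure_pmf.emeasure_eq_measure[symmetric])
  also have "\<dots> = ennreal (p * measure_pmf.prob (F True) B + (1 - p) * measure_pmf.prob (F False) B)"
    using assms by (subst ennreal_plus) (auto simp: ennreal_mult mult.commute)
  finally show ?thesis
    using assms by (subst (asm) ennreal_inj) auto
qed

lemma prob_binomial_random_graph:
  assumes "0 \<le> p" "p \<le> 1"
  shows "measure_pmf.prob (binomial_random_graph n p) A =
    subset_expectation (complete_edges {1..n}) p (\<lambda>W. of_bool (W \<in> A))"
proof -
  define M where "M = complete_edges {1..n}"
  have fin: "finite M" unfolding M_def complete_edges_def by simp
  \<comment> \<open>The event \<open>B\<close> varies in the induction: once \<open>e\<close> is
    present, the other edges face the event \<open>{W. insert e W \<in> B}\<close>.\<close>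
  have "subset_expectation N p (\<lambda>W. of_bool (W \<in> B)) =
     measure_pmf.prob (map_pmf (\<lambda>X. {e \<in> N. X e}) (Pi_pmf N False (\<lambda>_. bernoulli_pmf p))) B"
    if "finite N" for N :: "nat set set" and B
    using that
  proof (induction N arbitrary: B)
    case empty
    show ?case by (simp add: measure_return_pmf indicator_def)
  next
    case (insert e N)
    define D where "D = Pi_pmf N False (\<lambda>_. bernoulli_pmf p)"
    have *: "{a \<in> insert e N. (X(e := b)) a} = (if b then insert e {a \<in> N. X a} else {a \<in> N. X a})" for X b
      using insert.hyps by auto
    have "map_pmf (\<lambda>X. {a \<in> insert e N. X a}) (Pi_pmf (insert e N) False (\<lambda>_. bernoulli_pmf p)) =
        bernoulli_pmf p \<bind> (\<lambda>b. map_pmf (\<lambda>X. {a \<in> insert e N. (X(e := b)) a}) D)"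
      using insert.hyps
      by (simp add: Pi_pmf_insert' map_bind_pmf map_pmf_def[symmetric] D_def map_pmf_comp)
    then have "measure_pmf.prob (map_pmf (\<lambda>X. {a \<in> insert e N. X a})
           (Pi_pmf (insert e N) False (\<lambda>_. bernoulli_pmf p))) B =
        measure_pmf.prob (bernoulli_pmf p \<bind>
          (\<lambda>b. map_pmf (\<lambda>X. if b then insert e {a \<in> N. X a} else {a \<in> N. X a}) D)) B"
      by (simp only: *)
    also have "\<dots> = p * measure_pmf.prob (map_pmf (\<lambda>X. insert e {a \<in> N. X a}) D) B
         + (1 - p) * measure_pmf.prob (map_pmf (\<lambda>X. {a \<in> N. X a}) D) B"
      using assms by (simp add: prob_bind_bernoulli_pmf)
    also have "measure_pmf.prob (map_pmf (\<lambda>X. insert e {a \<in> N. X a}) D) B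
       = measure_pmf.prob (map_pmf (\<lambda>X. {a \<in> N. X a}) D) {W. insert e W \<in> B}"
      by (simp add: vimage_def)
    finally show ?case
      using insert.hyps insert.IH[of B] insert.IH[of "{W. insert e W \<in> B}"]
      by (simp add: subset_expectation_insert D_def)
  qed
  from this[OF fin] show ?thesis
    unfolding binomial_random_graph_def M_def by simp
qed

section \<open>Minimal fragments\<close>

definition containing :: "'i set \<Rightarrow> ('i \<Rightarrow> 'a set) \<Rightarrow> 'a set \<Rightarrow> 'i set" where
  "containing H S T = {i \<in> H. T \<subseteq> S i}"

text \<open>The statement that the rounds hand on: \<open>k\<close> bounds the fragments still to be
  found, \<open>q\<close> is the density still to be revealed and \<open>\<delta>\<close> bounds the
  probability of failure. All large families \<open>G\<close> and all fragments \<open>f\<close> are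
  allowed because the earlier rounds determine them.\<close>

definition fragment_cover ::
    "'a set \<Rightarrow> 'i set \<Rightarrow> ('i \<Rightarrow> 'a set) \<Rightarrow> real \<Rightarrow> nat \<Rightarrow> real \<Rightarrow> real \<Rightarrow> bool" where
  "fragment_cover M H S g k q \<delta> \<longleftrightarrow>
    (\<forall>G f. G \<subseteq> H \<longrightarrow> g \<le> real (card G) \<longrightarrow> (\<forall>i\<in>G. f i \<subseteq> S i \<and> card (f i) \<le> k) \<longrightarrow>
      subset_expectation M q (\<lambda>W. of_bool (\<not> (\<exists>i\<in>G. f i \<subseteq> W))) \<le> \<delta>)"

lemma fragment_cover_base:
  assumes "finite M" "\<And>i. i \<in> H \<Longrightarrow> S i \<subseteq> M" "g > 0"
  shows "fragment_cover M H S g 0 q 0"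
  unfolding fragment_cover_def
proof (intro allI impI)
  fix G :: "'b set" and f
  assume G: "G \<subseteq> H" "g \<le> real (card G)" "\<forall>i\<in>G. f i \<subseteq> S i \<and> card (f i) \<le> 0"
  from G(2) assms(3) obtain i where i: "i \<in> G" by fastforce
  with G assms have "finite (f i)" by (meson finite_subset subsetD)
  with G i have "f i = {}" by auto
  then have "\<And>W. \<exists>i\<in>G. f i \<subseteq> W" using i by blast
  then show "subset_expectation M q (\<lambda>W. of_bool (\<not> (\<exists>i\<in>G. f i \<subseteq> W))) \<le> 0"
    by (simp add: subset_expectation_const[OF assms(1)])
qed

text \<open>After revealing \<open>W\<close> with density \<open>p\<close>, each \<open>f i\<close>
  is replaced by a smallest set \<open>f j - W\<close> with
  \<open>f j \<subseteq> f i \<union> W\<close>. The expected number of indices whose new fragment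
  has more than \<open>k'\<close> elements is at most \<open>\<epsilon> * g\<close>. By Markov's
  inequality, at least \<open>g\<close> of the \<open>2 * g\<close> indices survive with probability
  at least \<open>1 - \<epsilon>\<close>, and \<open>cover\<close> applies to them.\<close>

lemma fragment_cover_step:
  assumes fin: "finite M" "finite H" and SM: "\<And>i. i \<in> H \<Longrightarrow> S i \<subseteq> M"
    and p: "0 < p" "p \<le> 1" and q: "0 \<le> q" "q \<le> 1" and g: "g > 0" and \<delta>: "\<delta> \<ge> 0"
    and cover: "fragment_cover M H S g k' q \<delta>"
    and weight: "\<And>i J. i \<in> H \<Longrightarrow> J \<subseteq> S i \<Longrightarrow> card J \<le> k \<Longrightarrow>
      (\<Sum>T | T \<subseteq> J \<and> k' < card T. (1 / p) ^ card T * real (card (containing H S T))) \<le> \<epsilon> * g"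
  shows "fragment_cover M H S (2 * g) k (p + q - p * q) (\<delta> + \<epsilon>)"
  unfolding fragment_cover_def
proof (intro allI impI)
  fix G :: "'b set" and f
  assume G: "G \<subseteq> H" "2 * g \<le> real (card G)" and f: "\<forall>i\<in>G. f i \<subseteq> S i \<and> card (f i) \<le> k"
  have finG: "finite G" using G fin by (auto intro: finite_subset)
  have fM: "f i \<subseteq> M" if "i \<in> G" for i using that f G SM by blast
  have finf: "finite (f i)" if "i \<in> G" for i using fM[OF that] fin by (auto intro: finite_subset)
  define cand where "cand i W = {f j - W |j. j \<in> G \<and> f j \<subseteq> f i \<union> W}" for i W
  define frag where "frag i W = arg_min_on card (cand i W)" for i W
  have fin_cand: "finite (cand i W)" for i W
    unfolding cand_def using finG by simp
  have frag_in: "frag i W \<in> cand i W" if "i \<in> G" for i W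
    unfolding frag_def by (rule arg_min_if_finite(1)[OF fin_cand]) (use that in \<open>auto simp: cand_def\<close>)
  have frag_le: "card (frag i W) \<le> card T" if "T \<in> cand i W" for i W T
    unfolding frag_def by (rule arg_min_least[OF fin_cand _ that]) (use that in auto)
  have frag_sub: "frag i W \<subseteq> f i" if "i \<in> G" for i W
    using frag_in[OF that, of W] by (auto simp: cand_def)
  define bad where "bad W = {i \<in> G. k' < card (frag i W)}" for W
  have fin_bad: "finite (bad W)" for W unfolding bad_def using finG by simp
  define w where "w W = p ^ card W * (1 - p) ^ card (M - W)" for W :: "'a set"
  have w0: "w W \<ge> 0" for W unfolding w_def using p by simp
  define J where "J Z = f (SOME j. j \<in> G \<and> f j \<subseteq> Z)" for Z
  have J: "\<exists>j\<in>G. J Z = f j \<and> f j \<subseteq> Z" if "j \<in> G" "f j \<subseteq> Z" for j Z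
    using someI[of "\<lambda>j. j \<in> G \<and> f j \<subseteq> Z" j] that unfolding J_def by blast
  define R where "R Z = (if \<exists>j\<in>G. f j \<subseteq> Z then SIGMA T:{T. T \<subseteq> J Z \<and> k' < card T}. containing H S T else {})" for Z
  have finJ: "finite (J Z)" if "\<exists>j\<in>G. f j \<subseteq> Z" for Z
    using J that finf by metis
  have finR: "finite (R Z)" for Z
    unfolding R_def containing_def using finJ fin by auto
  \<comment> \<open>A bad pair \<open>(W, i)\<close> is recovered from \<open>Z = W \<union> T\<close>, the fragment \<open>T\<close> and \<open>i\<close>, and minimality
      of \<open>T\<close> forces \<open>T \<subseteq> J Z\<close> for a set \<open>J Z\<close> that depends on \<open>Z\<close> only.\<close>
  have "subset_expectation M p (\<lambda>W. real (card (bad W))) = (\<Sum>(W, i)\<in>(SIGMA W:Pow M. bad W). w W)"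
    unfolding subset_expectation_def w_def
    by (subst sum.Sigma[symmetric]) (use fin fin_bad in \<open>auto simp: algebra_simps\<close>)
  also have "\<dots> \<le> (\<Sum>(Z, T, i)\<in>(SIGMA Z:Pow M. R Z). w Z * (1 / p) ^ card T)"
  proof (rule sum_le_included[where i = "\<lambda>(Z, T, i). (Z - T, i)"])
    show "finite (SIGMA W:Pow M. bad W)" "finite (SIGMA Z:Pow M. R Z)"
      using fin fin_bad finR by auto
    show "\<forall>y\<in>SIGMA Z:Pow M. R Z. 0 \<le> (case y of (Z, T, i) \<Rightarrow> w Z * (1 / p) ^ card T)"
      using w0 p by (auto intro!: mult_nonneg_nonneg divide_nonneg_nonneg)
    show "\<forall>x\<in>SIGMA W:Pow M. bad W. \<exists>y\<in>SIGMA Z:Pow M. R Z. (case y of (Z, T, i) \<Rightarrow> (Z - T, i)) = x \<and>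
      (case x of (W, i) \<Rightarrow> w W) \<le> (case y of (Z, T, i) \<Rightarrow> w Z * (1 / p) ^ card T)"
    proof clarify
      fix W i assume W: "W \<subseteq> M" and i: "i \<in> bad W"
      then have iG: "i \<in> G" and kT: "k' < card (frag i W)" by (auto simp: bad_def)
      define T where "T = frag i W"
      define Z where "Z = W \<union> T"
      from frag_in[OF iG, of W] obtain j where j: "j \<in> G" "T = f j - W" "f j \<subseteq> f i \<union> W"
        unfolding cand_def T_def by auto
      have Ti: "T \<subseteq> f i" unfolding T_def by (rule frag_sub[OF iG])
      have finT: "finite T" using Ti finf[OF iG] finite_subset by blast
      have ZM: "Z \<subseteq> M" using W Ti fM[OF iG] by (auto simp: Z_def)
      have jZ: "f j \<subseteq> Z" using j by (auto simp: Z_def)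
      from J[OF j(1) jZ] obtain l where l: "l \<in> G" "J Z = f l" "f l \<subseteq> Z" by blast
      \<comment> \<open>Since \<open>f l \<subseteq> W \<union> T\<close> and
        \<open>T \<subseteq> f i\<close>, the set \<open>f l - W\<close> competes with
        \<open>T\<close>. It is contained in \<open>T\<close>, so minimality makes the two
        equal.\<close>
      have "f l - W \<in> cand i W" using l Ti by (auto simp: cand_def Z_def)
      then have "card T \<le> card (f l - W)" unfolding T_def by (rule frag_le)
      moreover have "f l - W \<subseteq> T" using l by (auto simp: Z_def)
      ultimately have "f l - W = T" using finT by (meson card_seteq)
      then have TJ: "T \<subseteq> J Z" using l by auto
      have TR: "(T, i) \<in> R Z"
        using TJ kT Ti f iG G jZ j by (auto simp: R_def containing_def T_def[symmetric])
      have disj: "W \<inter> T = {}" using j by auto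
      have ZW: "Z - T = W" using disj by (auto simp: Z_def)
      have finW: "finite W" using W fin finite_subset by blast
      have cZ: "card Z = card W + card T" unfolding Z_def using finW finT disj by (rule card_Un_disjoint)
      have le: "card (M - Z) \<le> card (M - W)" using fin by (intro card_mono) (auto simp: Z_def)
      \<comment> \<open>Fewer factors \<open>1 - p \<le> 1\<close> remain after enlarging
        \<open>W\<close> to \<open>Z\<close>; the additional powers of \<open>p\<close> are
        cancelled by \<open>(1 / p) ^ card T\<close>.\<close>
      have "w W \<le> p ^ card W * (1 - p) ^ card (M - Z)"
        unfolding w_def using p le by (intro mult_left_mono power_decreasing) auto
      also have "\<dots> = w Z * (1 / p) ^ card T"
        unfolding w_def cZ using p by (simp add: power_add power_divide)
      finally show "\<exists>y\<in>SIGMA Z:Pow M. R Z. (case y of (Z, T, i) \<Rightarrow> (Z - T, i)) = (W, i) \<and>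
        w W \<le> (case y of (Z, T, i) \<Rightarrow> w Z * (1 / p) ^ card T)"
        using ZW TR ZM by (intro bexI[of _ "(Z, T, i)"]) auto
    qed
  qed
  also have "\<dots> = (\<Sum>Z\<in>Pow M. w Z * (\<Sum>(T, i)\<in>R Z. (1 / p) ^ card T))"
    by (subst sum.Sigma[symmetric]) (use fin finR in \<open>auto simp: sum_distrib_left split_def\<close>)
  also have "\<dots> \<le> (\<Sum>Z\<in>Pow M. w Z * (\<epsilon> * g))"
  proof (intro sum_mono mult_left_mono w0)
    fix Z assume "Z \<in> Pow M"
    show "(\<Sum>(T, i)\<in>R Z. (1 / p) ^ card T) \<le> \<epsilon> * g"
    proof (cases "\<exists>j\<in>G. f j \<subseteq> Z")
      case True
      then obtain l where l: "l \<in> G" "J Z = f l" using J by metis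
      have "(\<Sum>(T, i)\<in>R Z. (1 / p) ^ card T) =
        (\<Sum>T | T \<subseteq> J Z \<and> k' < card T. (1 / p) ^ card T * real (card (containing H S T)))"
        using True finJ[OF True] fin unfolding R_def
        by (simp only: if_True, subst sum.Sigma[symmetric]) (auto simp: containing_def mult.commute)
      also have "\<dots> \<le> \<epsilon> * g" using weight[of l "J Z"] l G f by auto
      finally show ?thesis .
    next
      case False
      \<comment> \<open>The right-hand side is nonnegative: \<open>weight\<close> is used with the
        empty set in place of \<open>J\<close>.\<close>
      obtain i where "i \<in> G" using G g by fastforce
      then have "(\<Sum>T | T \<subseteq> {} \<and> k' < card T. (1 / p) ^ card T * real (card (containing H S T))) \<le> \<epsilon> * g"
        using G by (intro weight) auto
      moreover have "{T. T \<subseteq> ({} :: 'a set) \<and> k' < card T} = {}" by auto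
      ultimately have "0 \<le> \<epsilon> * g" by (simp only: sum.empty)
      then show ?thesis using False by (simp add: R_def)
    qed
  qed
  also have "\<dots> = \<epsilon> * g"
    using subset_expectation_const[OF fin(1), of p "\<epsilon> * g"] by (simp add: subset_expectation_def w_def)
  finally have bad_bound: "subset_expectation M p (\<lambda>W. real (card (bad W))) \<le> \<epsilon> * g" .
  define fail :: "'a set \<Rightarrow> real" where "fail W = of_bool (\<not> (\<exists>i\<in>G. f i \<subseteq> W))" for W
  have "subset_expectation M (p + q - p * q) fail =
      subset_expectation M p (\<lambda>W. subset_expectation M q (\<lambda>W'. fail (W \<union> W')))"
    by (rule subset_expectation_union[OF fin(1)])
  also have "\<dots> \<le> subset_expectation M p (\<lambda>W. \<delta> + 1 / g * real (card (bad W)))"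
  proof (rule subset_expectation_mono)
    fix W assume "W \<subseteq> M"
    show "subset_expectation M q (\<lambda>W'. fail (W \<union> W')) \<le> \<delta> + 1 / g * real (card (bad W))"
    \<comment> \<open>Markov's inequality in pointwise form: if more than \<open>g\<close> indices
      are bad, the last summand alone exceeds 1; otherwise \<open>cover\<close> applies to
      \<open>G - bad W\<close>.\<close>
    proof (cases "real (card (bad W)) \<le> g")
      case True
      have "card (G - bad W) = card G - card (bad W)" "card (bad W) \<le> card G"
        using finG by (auto simp: bad_def intro!: card_Diff_subset card_mono)
      then have "g \<le> real (card (G - bad W))" using True G(2) by simp
      moreover have "\<forall>i\<in>G - bad W. frag i W \<subseteq> S i \<and> card (frag i W) \<le> k'"
        using frag_sub f by (fastforce simp: bad_def)
      moreover have "G - bad W \<subseteq> H" using G by auto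
      ultimately have "subset_expectation M q (\<lambda>W'. of_bool (\<not> (\<exists>i\<in>G - bad W. frag i W \<subseteq> W'))) \<le> \<delta>"
        using cover unfolding fragment_cover_def by (auto dest!: spec[of _ "G - bad W"] spec[of _ "\<lambda>i. frag i W"])
      moreover have "subset_expectation M q (\<lambda>W'. fail (W \<union> W')) \<le>
          subset_expectation M q (\<lambda>W'. of_bool (\<not> (\<exists>i\<in>G - bad W. frag i W \<subseteq> W')))"
      proof (rule subset_expectation_mono[OF q])
        fix W'
        have "\<exists>i\<in>G. f i \<subseteq> W \<union> W'" if "i \<in> G" "frag i W \<subseteq> W'" for i
          using frag_in[OF that(1), of W] that(2) by (auto simp: cand_def)
        then show "fail (W \<union> W') \<le> of_bool (\<not> (\<exists>i\<in>G - bad W. frag i W \<subseteq> W'))"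
          by (auto simp: fail_def)
      qed
      moreover have "0 \<le> 1 / g * real (card (bad W))" using g by simp
      ultimately show ?thesis by linarith
    next
      case False
      have "subset_expectation M q (\<lambda>W'. fail (W \<union> W')) \<le> subset_expectation M q (\<lambda>_. 1)"
        by (rule subset_expectation_mono[OF q]) (auto simp: fail_def)
      also have "\<dots> = 1" by (rule subset_expectation_const[OF fin(1)])
      also have "\<dots> \<le> 1 / g * real (card (bad W))" using False g by (simp add: field_simps)
      finally show ?thesis using \<delta> by linarith
    qed
  qed (use p in auto)
  also have "\<dots> = \<delta> + 1 / g * subset_expectation M p (\<lambda>W. real (card (bad W)))"
    by (simp only: subset_expectation_add subset_expectation_cmult subset_expectation_const[OF fin(1)])
  also have "\<dots> \<le> \<delta> + 1 / g * (\<epsilon> * g)"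
    using bad_bound g by (intro add_left_mono mult_left_mono) auto
  also have "\<dots> = \<delta> + \<epsilon>" using g by simp
  finally show "subset_expectation M (p + q - p * q) (\<lambda>W. of_bool (\<not> (\<exists>i\<in>G. f i \<subseteq> W))) \<le> \<delta> + \<epsilon>"
    unfolding fail_def .
qed

section \<open>Counting\<close>

text \<open>The exponent of \<open>y\<close> counts the runs of consecutive numbers in
  \<open>A\<close>. A new largest element \<open>b\<close> either starts a run, at a cost of
  \<open>x * y\<close>, or prolongs the run ending just before it, at a cost of \<open>x\<close>. As
  \<open>x \<le> 1 / 2\<close>, the prolongations form a convergent geometric series, so each
  element of \<open>X\<close> contributes at most a factor \<open>1 + 2 * x * y\<close>.\<close>

lemma sum_run_starts_le:
  fixes x y :: real and X :: "nat set"
  assumes x: "0 \<le> x" "x \<le> 1 / 2" and y: "0 \<le> y" and fin: "finite X"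
  shows "(\<Sum>A\<in>Pow X. x ^ card A * y ^ card (A - Suc ` A)) \<le> (1 + 2 * x * y) ^ card X"
proof -
  define w where "w A = x ^ card A * y ^ card (A - Suc ` A)" for A
  define P where "P X = (\<Sum>A\<in>Pow X. w A)" for X
  define E where "E X m = (\<Sum>A | A \<subseteq> X \<and> m \<in> A. w A)" for X m
  have w0: "w A \<ge> 0" for A unfolding w_def using x y by simp
  have P0: "P X \<ge> 0" for X unfolding P_def by (simp add: sum_nonneg w0)
  \<comment> \<open>\<open>E X m\<close> is the contribution of the sets whose last run can be continued to \<open>m + 1\<close>.\<close>
  have "P X \<le> (1 + 2 * x * y) ^ card X \<and> (\<forall>m. (\<forall>a\<in>X. a \<le> m) \<longrightarrow> E X m \<le> 2 * x * y * P X)"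
    using fin
  proof (induction rule: finite_linorder_max_induct)
    case empty
    have "{A. A \<subseteq> {} \<and> m \<in> A} = {}" for m :: nat by auto
    then have "E {} m = 0" for m unfolding E_def by (simp only: sum.empty)
    moreover have "P {} = 1" by (simp add: P_def w_def)
    ultimately show ?case using x y by simp
  next
    case (insert b X)
    have b: "b \<notin> X" using insert.hyps by auto
    have inj: "inj_on (insert b) (Pow X)" using b by (auto simp: inj_on_def)
    have disj: "Pow X \<inter> insert b ` Pow X = {}" using b by auto
    define F where "F = (\<Sum>A\<in>Pow X. w (insert b A))"
    have P_insert: "P (insert b X) = P X + F"
      unfolding P_def Pow_insert F_def using insert.hyps disj
      by (simp add: sum.union_disjoint sum.reindex[OF inj])
    have w_insert: "w (insert b A) \<le> x * (if b \<in> Suc ` A then w A else 0) + x * y * w A" if "A \<in> Pow X" for A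
    proof -
      have A: "finite A" "b \<notin> A" "Suc b \<notin> A"
        using that insert.hyps b by (auto intro: finite_subset) force
      have "insert b A - Suc ` insert b A = (if b \<in> Suc ` A then A - Suc ` A else insert b (A - Suc ` A))"
        using A by auto
      then have "w (insert b A) = x * (if b \<in> Suc ` A then 1 else y) * w A"
        using A by (auto simp: w_def)
      then show ?thesis using x y w0[of A] by (auto simp: mult.assoc)
    qed
    have "(\<Sum>A\<in>Pow X. if b \<in> Suc ` A then w A else 0) \<le> 2 * x * y * P X"
    proof (cases b)
      case 0
      then show ?thesis using x y P0 by auto
    next
      case (Suc m)
      have "(\<Sum>A\<in>Pow X. if b \<in> Suc ` A then w A else 0) = E X m"
        unfolding E_def Suc using insert.hyps
        by (subst sum.inter_filter[symmetric]) (auto intro!: sum.cong)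
      also have "\<dots> \<le> 2 * x * y * P X" using insert.IH insert.hyps(2) Suc by (simp add: less_Suc_eq_le)
      finally show ?thesis .
    qed
    \<comment> \<open>Half of the bound \<open>2 * x * y * P X\<close> is spent on prolonged runs,
      which leaves the other half for new runs.\<close>
    then have "x * (\<Sum>A\<in>Pow X. if b \<in> Suc ` A then w A else 0) \<le> (1 / 2) * (2 * x * y * P X)"
      using x y P0 by (intro mult_mono) (auto intro!: sum_nonneg w0)
    moreover have "F \<le> x * (\<Sum>A\<in>Pow X. if b \<in> Suc ` A then w A else 0) + x * y * P X"
      unfolding F_def P_def sum_distrib_left sum.distrib[symmetric] using w_insert by (rule sum_mono)
    ultimately have F: "F \<le> 2 * x * y * P X" by simp
    have F0: "F \<ge> 0" unfolding F_def by (simp add: sum_nonneg w0)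
    have "P (insert b X) \<le> (1 + 2 * x * y) * P X"
      using F P_insert by (simp add: algebra_simps)
    also have "\<dots> \<le> (1 + 2 * x * y) * (1 + 2 * x * y) ^ card X"
      using insert.IH x y by (intro mult_left_mono) auto
    finally have 1: "P (insert b X) \<le> (1 + 2 * x * y) ^ card (insert b X)"
      using insert.hyps b by simp
    have 2: "E (insert b X) m \<le> 2 * x * y * P (insert b X)" if m: "\<forall>a\<in>insert b X. a \<le> m" for m
    proof (cases "m = b")
      case True
      have "{A. A \<subseteq> insert b X \<and> b \<in> A} = insert b ` Pow X"
      proof safe
        fix A assume "A \<subseteq> insert b X" "b \<in> A"
        then have "A = insert b (A - {b})" "A - {b} \<in> Pow X" by auto
        then show "A \<in> insert b ` Pow X" by blast
      qed auto
      then have "E (insert b X) m = F"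
        unfolding E_def F_def True by (simp add: sum.reindex[OF inj])
      also have "\<dots> \<le> 2 * x * y * P (insert b X)"
        using F F0 P_insert x y by (smt (verit) mult_left_mono mult_nonneg_nonneg)
      finally show ?thesis .
    next
      case False
      then have "m \<notin> insert b X" using m insert.hyps by force
      then have "{A. A \<subseteq> insert b X \<and> m \<in> A} = {}" by auto
      then have "E (insert b X) m = 0" unfolding E_def by (simp only: sum.empty)
      then show ?thesis using x y P0 by simp
    qed
    show ?case using 1 2 by blast
  qed
  then show ?thesis unfolding P_def w_def by blast
qed

text \<open>Values are chosen in increasing order of the arguments. When \<open>i \<in> A\<close> is
  reached, \<open>par i\<close> has its value already, which leaves at most \<open>c\<close>
  choices; any other element has \<open>card N\<close> choices.\<close>

lemma card_constrained_functions:
  fixes U :: "nat set" and D :: "'b \<Rightarrow> 'b set"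
  assumes "finite U" and N: "finite N"
    and D: "\<And>x. x \<in> N \<Longrightarrow> finite (D x)" "\<And>x. x \<in> N \<Longrightarrow> card (D x) \<le> c"
    and "\<And>i. i \<in> A \<inter> U \<Longrightarrow> par i \<in> U \<and> par i < i"
  shows "finite {h \<in> U \<rightarrow>\<^sub>E N. \<forall>i\<in>A \<inter> U. h i \<in> D (h (par i))} \<and>
    card {h \<in> U \<rightarrow>\<^sub>E N. \<forall>i\<in>A \<inter> U. h i \<in> D (h (par i))} \<le> card N ^ card (U - A) * c ^ card (A \<inter> U)"
  using assms(1,5)
proof (induction rule: finite_linorder_max_induct)
  case empty
  then show ?case by simp
next
  case (insert b U)
  define F where "F U = {h \<in> U \<rightarrow>\<^sub>E N. \<forall>i\<in>A \<inter> U. h i \<in> D (h (par i))}" for U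
  have b: "b \<notin> U" using insert.hyps by auto
  have par: "par i \<in> U \<and> par i < i" if "i \<in> A \<inter> U" for i
    using insert.prems[of i] insert.hyps(2) that by force
  have parb: "par b \<in> U" if "b \<in> A"
    using insert.prems[of b] that by auto
  have IH: "finite (F U)" "card (F U) \<le> card N ^ card (U - A) * c ^ card (A \<inter> U)"
    using insert.IH[OF par] unfolding F_def by auto
  define B where "B h = (if b \<in> A then D (h (par b)) else N)" for h
  define m where "m = (if b \<in> A then c else card N)"
  have B: "finite (B h)" "card (B h) \<le> m" if "h \<in> F U" for h
  proof -
    have "h (par b) \<in> N" if "b \<in> A" using parb[OF that] \<open>h \<in> F U\<close> by (auto simp: F_def)
    then show "finite (B h)" "card (B h) \<le> m" using N D by (auto simp: B_def m_def)
  qed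
  have fin: "finite (SIGMA h:F U. B h)" using IH B by auto
  have finF: "finite (F (insert b U))"
    unfolding F_def using insert.hyps N by (auto intro!: finite_PiE)
  have "card (F (insert b U)) \<le> card (SIGMA h:F U. B h)"
  proof (rule card_inj_on_le[OF _ _ fin])
    let ?r = "\<lambda>h. (restrict h U, h b)"
    show "inj_on ?r (F (insert b U))"
    proof (rule inj_onI)
      fix h h' assume h: "h \<in> F (insert b U)" "h' \<in> F (insert b U)" "?r h = ?r h'"
      show "h = h'"
      proof (rule PiE_ext[of _ "insert b U" "\<lambda>_. N"])
        show "h \<in> insert b U \<rightarrow>\<^sub>E N" "h' \<in> insert b U \<rightarrow>\<^sub>E N" using h by (auto simp: F_def)
        show "h x = h' x" if "x \<in> insert b U" for x
          using h(3) that by (metis insertE prod.inject restrict_apply')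
      qed
    qed
    show "?r ` F (insert b U) \<subseteq> (SIGMA h:F U. B h)"
    proof clarify
      fix h assume h: "h \<in> F (insert b U)"
      have "restrict h U \<in> F U" using h par by (auto simp: F_def)
      moreover have "h b \<in> B (restrict h U)" using h parb by (auto simp: F_def B_def)
      ultimately show "restrict h U \<in> F U \<and> h b \<in> B (restrict h U)" ..
    qed
  qed
  also have "\<dots> = (\<Sum>h\<in>F U. card (B h))" using IH B by (intro card_SigmaI) auto
  also have "\<dots> \<le> card (F U) * m" using sum_bounded_above[of "F U" "\<lambda>h. card (B h)" m] B by simp
  also have "\<dots> \<le> card N ^ card (U - A) * c ^ card (A \<inter> U) * m" using IH by (intro mult_right_mono) auto
  also have "\<dots> = card N ^ card (insert b U - A) * c ^ card (A \<inter> insert b U)"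
    using b insert.hyps by (auto simp: m_def insert_Diff_if)
  finally show ?case using finF unfolding F_def by blast
qed

lemma card_permutes_extending:
  assumes "finite N" "U \<subseteq> N" "\<phi> permutes N"
  shows "card {\<psi>. \<psi> permutes N \<and> (\<forall>u\<in>U. \<psi> u = \<phi> u)} \<le> fact (card N - card U)"
proof -
  have "card {\<psi>. \<psi> permutes N \<and> (\<forall>u\<in>U. \<psi> u = \<phi> u)} \<le> card {\<psi>. \<psi> permutes (N - U)}"
  proof (rule card_inj_on_le[where f = "\<lambda>\<psi>. inv \<phi> \<circ> \<psi>"])
    show "inj_on (\<lambda>\<psi>. inv \<phi> \<circ> \<psi>) {\<psi>. \<psi> permutes N \<and> (\<forall>u\<in>U. \<psi> u = \<phi> u)}"
      by (rule inj_on_inverseI[where g = "\<lambda>\<psi>. \<phi> \<circ> \<psi>"])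
        (simp add: comp_assoc[symmetric] permutes_inv_o(1)[OF assms(3)])
    show "(\<lambda>\<psi>. inv \<phi> \<circ> \<psi>) ` {\<psi>. \<psi> permutes N \<and> (\<forall>u\<in>U. \<psi> u = \<phi> u)} \<subseteq> {\<psi>. \<psi> permutes (N - U)}"
    proof clarify
      fix \<psi> assume \<psi>: "\<psi> permutes N" "\<forall>u\<in>U. \<psi> u = \<phi> u"
      have "inv \<phi> \<circ> \<psi> permutes N" using \<psi> assms by (intro permutes_compose permutes_inv)
      moreover have "(inv \<phi> \<circ> \<psi>) x = x" if "x \<in> N - (N - U)" for x
        using that \<psi> permutes_inverses(2)[OF assms(3)] by auto
      ultimately show "inv \<phi> \<circ> \<psi> permutes (N - U)" by (rule permutes_superset)
    qed
    show "finite {\<psi>. \<psi> permutes (N - U)}" using assms by (intro finite_permutations) auto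
  qed
  also have "\<dots> = fact (card N - card U)"
    using assms by (intro card_permutations) (auto simp: card_Diff_subset finite_subset)
  finally show ?thesis .
qed

text \<open>\<open>card_constrained_functions\<close> bounds the restrictions to \<open>U\<close>,
  and each restriction extends in at most \<open>fact (card N - card U)\<close> ways.\<close>

lemma card_constrained_permutations:
  fixes N :: "nat set"
  assumes N: "finite N" and U: "A \<subseteq> U" "U \<subseteq> N"
    and D: "\<And>x. x \<in> N \<Longrightarrow> finite (D x)" "\<And>x. x \<in> N \<Longrightarrow> card (D x) \<le> c"
    and par: "\<And>i. i \<in> A \<Longrightarrow> par i \<in> U \<and> par i < i"
  shows "card {\<phi>. \<phi> permutes N \<and> (\<forall>i\<in>A. \<phi> i \<in> D (\<phi> (par i)))}
    \<le> card N ^ card (U - A) * c ^ card A * fact (card N - card U)"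
proof -
  define \<Phi> where "\<Phi> = {\<phi>. \<phi> permutes N \<and> (\<forall>i\<in>A. \<phi> i \<in> D (\<phi> (par i)))}"
  define F where "F = {h \<in> U \<rightarrow>\<^sub>E N. \<forall>i\<in>A \<inter> U. h i \<in> D (h (par i))}"
  have F: "finite F" "card F \<le> card N ^ card (U - A) * c ^ card A"
    using card_constrained_functions[of U N D c A par] assms finite_subset[OF U(2) N]
    by (auto simp: F_def Int_absorb2)
  have sub: "(\<lambda>\<phi>. restrict \<phi> U) ` \<Phi> \<subseteq> F"
    using U par by (auto simp: \<Phi>_def F_def permutes_in_image)
  have fin\<Phi>: "finite \<Phi>" unfolding \<Phi>_def using finite_permutations[OF N] by simp
  have "card \<Phi> = card (\<Union>h\<in>(\<lambda>\<phi>. restrict \<phi> U) ` \<Phi>. {\<phi> \<in> \<Phi>. restrict \<phi> U = h})"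
    by (rule arg_cong[where f = card]) auto
  also have "\<dots> \<le> (\<Sum>h\<in>(\<lambda>\<phi>. restrict \<phi> U) ` \<Phi>. card {\<phi> \<in> \<Phi>. restrict \<phi> U = h})"
    using fin\<Phi> by (intro card_UN_le) auto
  also have "\<dots> \<le> (\<Sum>h\<in>(\<lambda>\<phi>. restrict \<phi> U) ` \<Phi>. fact (card N - card U))"
  proof (rule sum_mono, clarify)
    fix \<phi> assume \<phi>: "\<phi> \<in> \<Phi>"
    have "card {\<psi> \<in> \<Phi>. restrict \<psi> U = restrict \<phi> U} \<le> card {\<psi>. \<psi> permutes N \<and> (\<forall>u\<in>U. \<psi> u = \<phi> u)}"
    proof (rule card_mono)
      show "finite {\<psi>. \<psi> permutes N \<and> (\<forall>u\<in>U. \<psi> u = \<phi> u)}" using finite_permutations[OF N] by simp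
      show "{\<psi> \<in> \<Phi>. restrict \<psi> U = restrict \<phi> U} \<subseteq> {\<psi>. \<psi> permutes N \<and> (\<forall>u\<in>U. \<psi> u = \<phi> u)}"
        by (auto simp: \<Phi>_def) (metis restrict_apply')
    qed
    also have "\<dots> \<le> fact (card N - card U)"
      using N U \<phi> by (intro card_permutes_extending) (auto simp: \<Phi>_def)
    finally show "card {\<psi> \<in> \<Phi>. restrict \<psi> U = restrict \<phi> U} \<le> fact (card N - card U)" .
  qed
  also have "\<dots> = card ((\<lambda>\<phi>. restrict \<phi> U) ` \<Phi>) * fact (card N - card U)" by simp
  also have "\<dots> \<le> card F * fact (card N - card U)"
    using card_mono[OF F(1) sub] by (rule mult_right_mono) simp
  also have "\<dots> \<le> card N ^ card (U - A) * c ^ card A * fact (card N - card U)"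
    using F(2) by (rule mult_right_mono) simp
  finally show ?thesis unfolding \<Phi>_def .
qed

text \<open>The estimate \<open>(n / u) ^ u \<le> n choose u\<close> reduces the claim to
  \<open>u ^ u / fact u \<le> exp u\<close>, where the left-hand side is a single term of the
  exponential series.\<close>

lemma power_fact_le_exp_fact:
  assumes "u \<le> n"
  shows "real n ^ u * fact (n - u) \<le> exp 1 ^ u * fact n"
proof (cases "u = 0")
  case False
  have "(real n / real u) ^ u \<le> real (n choose u)"
    by (rule binomial_ge_n_over_k_pow_k[OF assms])
  also have "\<dots> = fact n / (fact u * fact (n - u))"
    by (rule binomial_fact[OF assms])
  finally have 1: "real n ^ u * fact (n - u) \<le> fact n * (real u ^ u / fact u)"
    using False by (simp add: field_simps power_divide)
  have "(\<Sum>k\<in>{u}. real u ^ k /\<^sub>R fact k) \<le> (\<Sum>k. real u ^ k /\<^sub>R fact k)"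
    by (rule sum_le_suminf[OF summable_exp_generic]) auto
  then have "real u ^ u / fact u \<le> exp (real u)"
    unfolding exp_def by (simp add: divide_inverse mult.commute)
  also have "\<dots> = exp 1 ^ u" by (simp add: exp_of_nat_mult[symmetric])
  finally have "fact n * (real u ^ u / fact u) \<le> fact n * exp 1 ^ u"
    by (rule mult_left_mono) simp
  with 1 show ?thesis by (simp add: mult.commute)
qed simp

section \<open>Subgraphs of squares of cycles\<close>

text \<open>Cyclic distance at most \<open>k\<close> between residues modulo \<open>n\<close>. The
  integer \<open>d\<close> avoids the truncated subtraction of natural numbers.\<close>

definition near :: "nat \<Rightarrow> nat \<Rightarrow> nat \<Rightarrow> nat \<Rightarrow> bool" where
  "near n k a b \<longleftrightarrow> (\<exists>d::int. \<bar>d\<bar> \<le> int k \<and> int n dvd int b - int a - d)"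

lemma near_sym: "near n k a b \<Longrightarrow> near n k b a"
proof -
  assume "near n k a b"
  then obtain d where d: "\<bar>d\<bar> \<le> int k" "int n dvd int b - int a - d" by (auto simp: near_def)
  have "int n dvd - (int b - int a - d)" using d(2) by (simp only: dvd_minus_iff)
  then have "int n dvd int a - int b - (- d)" by (simp add: algebra_simps)
  then show ?thesis unfolding near_def using d(1) by (intro exI[of _ "- d"]) auto
qed

lemma near_trans: "near n k a b \<Longrightarrow> near n l b c \<Longrightarrow> near n (k + l) a c"
proof -
  assume "near n k a b" "near n l b c"
  then obtain d e where d: "\<bar>d\<bar> \<le> int k" "int n dvd int b - int a - d"
    and e: "\<bar>e\<bar> \<le> int l" "int n dvd int c - int b - e" by (auto simp: near_def)
  have "int n dvd (int b - int a - d) + (int c - int b - e)" using d e by (intro dvd_add)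
  then have "int n dvd int c - int a - (d + e)" by (simp add: algebra_simps)
  then show ?thesis unfolding near_def using d(1) e(1) by (intro exI[of _ "d + e"]) auto
qed

lemma near_mono: "near n k a b \<Longrightarrow> k \<le> l \<Longrightarrow> near n l a b"
  unfolding near_def by (meson of_nat_mono order_trans)

lemma near_refl: "near n k a a"
  unfolding near_def by (intro exI[of _ 0]) auto

lemma card_near_le: "card {b \<in> {1..n}. near n k a b} \<le> 2 * k + 1"
proof -
  have "{b \<in> {1..n}. near n k a b} \<subseteq> (\<lambda>d. nat ((int a + d - 1) mod int n) + 1) ` {- int k..int k}"
  proof
    fix b assume "b \<in> {b \<in> {1..n}. near n k a b}"
    then obtain d where b: "1 \<le> b" "b \<le> n" and d: "\<bar>d\<bar> \<le> int k" "int n dvd int b - int a - d"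
      by (auto simp: near_def)
    have "int n dvd (int b - 1) - (int a + d - 1)" using d by (simp add: algebra_simps)
    then have "(int a + d - 1) mod int n = (int b - 1) mod int n" by (metis mod_eq_dvd_iff)
    also have "\<dots> = int b - 1" using b by simp
    finally have "b = nat ((int a + d - 1) mod int n) + 1" using b by simp
    then show "b \<in> (\<lambda>d. nat ((int a + d - 1) mod int n) + 1) ` {- int k..int k}"
      by (rule image_eqI) (use d in auto)
  qed
  then have "card {b \<in> {1..n}. near n k a b} \<le> card {- int k..int k}"
    by (meson card_image_le card_mono finite_atLeastAtMost_int finite_imageI le_trans)
  then show ?thesis by simp
qed

text \<open>\<open>cyclic_square n \<pi>\<close> is the square of the Hamilton cycle that visits the vertex \<open>v\<close> at time \<open>\<pi> v\<close>.\<close>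

definition cyclic_square :: "nat \<Rightarrow> (nat \<Rightarrow> nat) \<Rightarrow> nat set set" where
  "cyclic_square n \<pi> = {{u, v} | u v. u \<in> {1..n} \<and> v \<in> {1..n} \<and> u \<noteq> v \<and> near n 2 (\<pi> u) (\<pi> v)}"

text \<open>Unlike in \<open>cyclic_square n id\<close>, no edge crosses the end, so the vertices
  can be embedded in increasing order.\<close>

definition path_square :: "nat \<Rightarrow> nat set set" where
  "path_square n = {{i, j} | i j. 1 \<le> i \<and> i < j \<and> j \<le> n \<and> j \<le> i + 2}"

lemma doubleton_in_cyclic_square_iff:
  "{u, v} \<in> cyclic_square n \<pi> \<longleftrightarrow> u \<in> {1..n} \<and> v \<in> {1..n} \<and> u \<noteq> v \<and> near n 2 (\<pi> u) (\<pi> v)"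
  unfolding cyclic_square_def by (auto simp: doubleton_eq_iff intro: near_sym)

lemma doubleton_in_path_square:
  "i < j \<Longrightarrow> {i, j} \<in> path_square n \<Longrightarrow> 1 \<le> i \<and> j \<le> n \<and> j \<le> i + 2"
  unfolding path_square_def by (auto simp: doubleton_eq_iff)

lemma singleton_notin_path_square: "{i} \<notin> path_square n"
  unfolding path_square_def by (auto simp: doubleton_eq_iff)

lemma cyclic_square_subset: "cyclic_square n \<pi> \<subseteq> complete_edges {1..n}"
  unfolding cyclic_square_def complete_edges_def by (auto simp: card_insert_if)

lemma finite_complete_edges: "finite V \<Longrightarrow> finite (complete_edges V)"
  unfolding complete_edges_def by simp

lemma path_square_subset: "path_square n \<subseteq> complete_edges {1..n}"
  unfolding path_square_def complete_edges_def by (auto simp: card_insert_if)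

lemma card_Union_complete_edges_le:
  assumes "finite V" "T \<subseteq> complete_edges V"
  shows "card (\<Union>T) \<le> 2 * card T"
proof -
  have "card (\<Union>T) \<le> (\<Sum>e\<in>T. card e)" by (rule card_Union_le_sum_card)
  also have "\<dots> = (\<Sum>e\<in>T. 2)" using assms by (intro sum.cong) (auto simp: complete_edges_def)
  finally show ?thesis by simp
qed

text \<open>The anchors of \<open>T\<close> are the vertices which are joined to an earlier vertex at distance at most 2
  either by an edge of \<open>T\<close> or by two edges of \<open>T\<close> through the next vertex. Given the images of the
  earlier vertices there are boundedly many possible images of an anchor, and every vertex which
  sends two edges of \<open>T\<close> backwards is preceded by an anchor.\<close>

definition anchors :: "nat set set \<Rightarrow> nat set" where
  "anchors T = {i. {i - 1, i} \<in> T \<or> {i - 2, i} \<in> T \<or> ({i, Suc i} \<in> T \<and> {i - 1, Suc i} \<in> T)}"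

lemma anchors_subset: "anchors T \<subseteq> \<Union>T"
  unfolding anchors_def by auto

text \<open>The constant 4 covers the third kind of anchor: two edges of \<open>T\<close> through
  the next vertex allow an offset of \<open>2 + 2\<close>, whereas a single edge gives only
  2.\<close>

lemma anchors_parent:
  assumes T: "T \<subseteq> path_square n" and i: "i \<in> anchors T"
  defines "par \<equiv> \<lambda>i. if {i - 1, i} \<in> T then i - 1 else if {i - 2, i} \<in> T then i - 2 else i - 1"
  shows "i \<in> {1..n}" "par i \<in> {1..n}" "par i < i"
    "T \<subseteq> cyclic_square n \<pi> \<Longrightarrow> near n 4 (\<pi> (par i)) (\<pi> i)"
proof -
  have "i \<in> {1..n} \<and> par i \<in> {1..n} \<and> par i < i \<and>
    (T \<subseteq> cyclic_square n \<pi> \<longrightarrow> near n 4 (\<pi> (par i)) (\<pi> i))"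
  proof -
    consider (1) "{i - 1, i} \<in> T" | (2) "{i - 1, i} \<notin> T" "{i - 2, i} \<in> T" |
      (3) "{i - 1, i} \<notin> T" "{i - 2, i} \<notin> T" "{i, Suc i} \<in> T" "{i - 1, Suc i} \<in> T"
      using i unfolding anchors_def by blast
    then show ?thesis
    proof cases
      case 1
      \<comment> \<open>Subtraction is truncated: for \<open>i = 0\<close> the pair would be a
        singleton, which is not an edge.\<close>
      then have "i \<noteq> 0" using T singleton_notin_path_square[of i n] by (intro notI) auto
      then have "1 \<le> i - 1 \<and> i \<le> n" using doubleton_in_path_square[of "i - 1" i n] 1 T by auto
      moreover have "near n 4 (\<pi> (i - 1)) (\<pi> i)" if "T \<subseteq> cyclic_square n \<pi>"
        using that 1 doubleton_in_cyclic_square_iff[of "i - 1" i n \<pi>] near_mono[of n 2 _ _ 4] by auto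
      ultimately show ?thesis using 1 by (auto simp: par_def)
    next
      case 2
      then have "i \<noteq> 0" using T singleton_notin_path_square[of i n] by (intro notI) auto
      then have "1 \<le> i - 2 \<and> i \<le> n" using doubleton_in_path_square[of "i - 2" i n] 2 T by auto
      moreover have "near n 4 (\<pi> (i - 2)) (\<pi> i)" if "T \<subseteq> cyclic_square n \<pi>"
        using that 2 doubleton_in_cyclic_square_iff[of "i - 2" i n \<pi>] near_mono[of n 2 _ _ 4] by auto
      ultimately show ?thesis using 2 by (auto simp: par_def)
    next
      case 3
      then have "1 \<le> i - 1 \<and> Suc i \<le> n" using doubleton_in_path_square[of "i - 1" "Suc i" n] T by auto
      moreover have "near n 4 (\<pi> (i - 1)) (\<pi> i)" if "T \<subseteq> cyclic_square n \<pi>"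
      proof -
        have "near n 2 (\<pi> (i - 1)) (\<pi> (Suc i))" "near n 2 (\<pi> (Suc i)) (\<pi> i)"
          using that 3 doubleton_in_cyclic_square_iff[of "i - 1" "Suc i" n \<pi>]
            doubleton_in_cyclic_square_iff[of i "Suc i" n \<pi>] by (auto intro: near_sym)
        from near_trans[OF this] show ?thesis by simp
      qed
      ultimately show ?thesis using 3 by (auto simp: par_def)
    qed
  qed
  then show "i \<in> {1..n}" "par i \<in> {1..n}" "par i < i"
    "T \<subseteq> cyclic_square n \<pi> \<Longrightarrow> near n 4 (\<pi> (par i)) (\<pi> i)" by auto
qed

text \<open>The later end of every edge of \<open>T\<close> is an anchor. So a given set of
  \<open>a\<close> anchors arises from at most \<open>4 ^ a\<close> sets \<open>T\<close>.\<close>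

lemma path_square_subset_anchor_edges:
  assumes "T \<subseteq> path_square n"
  shows "T \<subseteq> (\<Union>i\<in>anchors T. {{i - 1, i}, {i - 2, i}})"
proof
  fix e assume e: "e \<in> T"
  then obtain i j where ij: "e = {i, j}" "i < j" "j \<le> i + 2" using assms unfolding path_square_def by auto
  then have "i = j - 1 \<or> i = j - 2" by auto
  then have "j \<in> anchors T" "e \<in> {{j - 1, j}, {j - 2, j}}" using e ij by (auto simp: anchors_def)
  then show "e \<in> (\<Union>i\<in>anchors T. {{i - 1, i}, {i - 2, i}})" by blast
qed

lemma finite_anchors: "T \<subseteq> path_square n \<Longrightarrow> finite (anchors T)"
  by (rule finite_subset[of _ "{1..n}"]) (auto dest: anchors_parent(1))

text \<open>Every edge is charged to its later end, an anchor, which receives at most two. If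
  \<open>i\<close> receives both \<open>{i - 1, i}\<close> and \<open>{i - 2, i}\<close>, then
  \<open>i - 1\<close> is an anchor by the third clause of \<open>anchors\<close>; hence the first
  element of a run of anchors receives at most one edge.\<close>

lemma card_run_starts_le_anchors:
  assumes T: "T \<subseteq> path_square n"
  shows "card T + card (anchors T - Suc ` anchors T) \<le> 2 * card (anchors T)"
proof -
  let ?A = "anchors T"
  let ?E = "\<lambda>i. T \<inter> {{i - 1, i}, {i - 2, i}}"
  have finA: "finite ?A" using T by (rule finite_anchors)
  have "T = (\<Union>i\<in>?A. ?E i)" using path_square_subset_anchor_edges[OF T] by blast
  then have "card T = card (\<Union>i\<in>?A. ?E i)" by simp
  also have "\<dots> \<le> (\<Sum>i\<in>?A. card (?E i))" using finA by (rule card_UN_le)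
  also have "\<dots> \<le> (\<Sum>i\<in>?A. if i \<in> Suc ` ?A then 2 else 1)"
  proof (rule sum_mono)
    fix i assume i: "i \<in> ?A"
    have le2: "card (?E i) \<le> 2"
      using card_mono[of "{{i - 1, i}, {i - 2, i}}" "?E i"] by (auto simp: card_insert_if split: if_splits)
    show "card (?E i) \<le> (if i \<in> Suc ` ?A then 2 else 1)"
    proof (cases "i \<in> Suc ` ?A")
      case True
      then show ?thesis using le2 by simp
    next
      case False
      have "i \<ge> 1" using anchors_parent(1)[OF T i] by simp
      then have Suc: "Suc (i - 1) = i" by simp
      have "i - 1 \<notin> ?A" using False Suc by (metis imageI)
      moreover have "i - 1 - 1 = i - 2" by simp
      ultimately have "{i - 1, i} \<notin> T \<or> {i - 2, i} \<notin> T"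
        unfolding anchors_def using Suc by (metis (mono_tags, lifting) mem_Collect_eq)
      then have "?E i \<subseteq> {{i - 2, i}} \<or> ?E i \<subseteq> {{i - 1, i}}" by blast
      then have "card (?E i) \<le> 1"
        by (metis card.empty card_insert_disjoint card_mono empty_iff finite.emptyI finite.insertI One_nat_def)
      then show ?thesis using False by simp
    qed
  qed
  finally have "card T + card (?A - Suc ` ?A) \<le>
      (\<Sum>i\<in>?A. if i \<in> Suc ` ?A then 2 else 1) + (\<Sum>i\<in>?A. if i \<in> Suc ` ?A then 0 else 1)"
    using finA by (simp add: sum.If_cases Diff_eq)
  also have "\<dots> = (\<Sum>i\<in>?A. 2)"
    unfolding sum.distrib[symmetric] by (intro sum.cong) auto
  finally show ?thesis by simp
qed

text \<open>Squares are indexed by permutations and so counted with multiplicity; the whole family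
  has \<open>fact n\<close> members.\<close>

abbreviation square_copies :: "nat \<Rightarrow> nat set set \<Rightarrow> (nat \<Rightarrow> nat) set" where
  "square_copies n T \<equiv> containing {\<pi>. \<pi> permutes {1..n}} (cyclic_square n) T"

lemma finite_square_copies: "finite (square_copies n T)"
  unfolding containing_def by (simp add: finite_permutations)

text \<open>Given the image of its parent, an anchor has at most \<open>2 * 4 + 1 = 9\<close>
  images. For \<open>a\<close> anchors, the anchors and their parents form a set \<open>U\<close> of
  at most \<open>2 * a\<close> vertices, so at most
  \<open>n ^ (card U - a) * 9 ^ a * fact (n - card U)\<close> permutations qualify.
  \<open>power_fact_le_exp_fact\<close> absorbs the powers of \<open>n\<close> at the cost of a
  factor of at most \<open>exp 1 ^ (2 * a)\<close>.\<close>

lemma card_square_copies_le: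
  assumes T: "T \<subseteq> path_square n"
  shows "real (card (square_copies n T)) * real n ^ card (anchors T) \<le> (9 * exp 2) ^ card (anchors T) * fact n"
proof -
  define A where "A = anchors T"
  define par where "par i = (if {i - 1, i} \<in> T then i - 1 else if {i - 2, i} \<in> T then i - 2 else i - 1)" for i
  note par = anchors_parent[OF T, folded par_def A_def]
  define D where "D x = {y \<in> {1..n}. near n 4 x y}" for x
  define U where "U = A \<union> par ` A"
  have finA: "finite A" unfolding A_def using T by (rule finite_anchors)
  have UN: "U \<subseteq> {1..n}" using par unfolding U_def by blast
  have finU: "finite U" using UN by (rule finite_subset) simp
  have AU: "A \<subseteq> U" unfolding U_def by simp
  have "card (par ` A) \<le> card A" using finA by (rule card_image_le)
  then have U2: "card U \<le> 2 * card A" using card_Un_le[of A "par ` A"] unfolding U_def by linarith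
  have Un: "card U \<le> n" using card_mono[OF _ UN] by simp
  have UA: "card (U - A) + card A = card U"
    using AU finU finA by (simp add: card_Diff_subset card_mono)
  have "card (square_copies n T) \<le> card {\<phi>. \<phi> permutes {1..n} \<and> (\<forall>i\<in>A. \<phi> i \<in> D (\<phi> (par i)))}"
  proof (rule card_mono)
    show "finite {\<phi>. \<phi> permutes {1..n} \<and> (\<forall>i\<in>A. \<phi> i \<in> D (\<phi> (par i)))}"
      using finite_permutations[of "{1..n}"] by simp
    show "square_copies n T \<subseteq> {\<phi>. \<phi> permutes {1..n} \<and> (\<forall>i\<in>A. \<phi> i \<in> D (\<phi> (par i)))}"
    proof safe
      fix \<pi> i assume \<pi>: "\<pi> \<in> square_copies n T" and i: "i \<in> A"
      then have "\<pi> i \<in> {1..n}" using par(1) by (metis containing_def mem_Collect_eq permutes_in_image)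
      then show "\<pi> i \<in> D (\<pi> (par i))" using par(4)[OF i, of \<pi>] \<pi> by (auto simp: D_def containing_def)
    qed (simp add: containing_def)
  qed
  also have "\<dots> \<le> card {1..n} ^ card (U - A) * 9 ^ card A * fact (card {1..n} - card U)"
  proof (rule card_constrained_permutations[OF _ AU UN])
    show "card (D x) \<le> 9" for x using card_near_le[of n 4 x] unfolding D_def by simp
    show "par i \<in> U \<and> par i < i" if "i \<in> A" for i using par(3)[OF that] that by (auto simp: U_def)
  qed (auto simp: D_def)
  finally have "real (card (square_copies n T)) \<le> real (n ^ card (U - A) * 9 ^ card A * fact (n - card U))"
    by (simp only: of_nat_le_iff card_atLeastAtMost diff_Suc_1)
  then have "real (card (square_copies n T)) * real n ^ card A
      \<le> real (n ^ card (U - A) * 9 ^ card A * fact (n - card U)) * real n ^ card A"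
    by (rule mult_right_mono) simp
  also have "\<dots> = 9 ^ card A * (real n ^ card U * fact (n - card U))"
    unfolding UA[symmetric] by (simp add: power_add algebra_simps)
  also have "\<dots> \<le> 9 ^ card A * (exp 1 ^ card U * fact n)"
    using power_fact_le_exp_fact[OF Un] by (rule mult_left_mono) simp
  also have "\<dots> \<le> 9 ^ card A * (exp 1 ^ (2 * card A) * fact n)"
    using U2 by (intro mult_left_mono mult_right_mono power_increasing) auto
  also have "exp (1::real) ^ (2 * card A) = exp 2 ^ card A"
    by (simp add: power_mult exp_of_nat_mult[symmetric] power2_eq_square exp_add[symmetric])
  finally show ?thesis unfolding A_def by (simp add: power_mult_distrib)
qed

section \<open>Weights of fragments\<close>

text \<open>The sum in the hypothesis \<open>weight\<close> of \<open>fragment_cover_step\<close>,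
  for the family of all squares.\<close>

definition fragment_weight :: "nat \<Rightarrow> real \<Rightarrow> nat \<Rightarrow> nat set set \<Rightarrow> real" where
  "fragment_weight n p k J =
    (\<Sum>T | T \<subseteq> J \<and> k < card T. (1 / p) ^ card T * real (card (square_copies n T)))"

text \<open>The sets \<open>T\<close> are grouped by \<open>A = anchors T\<close>. For
  \<open>t\<close> edges, \<open>a\<close> anchors and \<open>s\<close> runs of anchors,
  \<open>t + s \<le> 2 * a\<close> and \<open>a \<le> 2 * t\<close> bound a summand by
  \<open>fact n * (9 * exp 2 / sqrt C) ^ a * (1 / sqrt n) ^ s\<close>. At most \<open>4 ^ a\<close>
  sets share their anchors, whence the constant 36, and \<open>k < t\<close> forces
  \<open>k < 2 * a\<close>.\<close>

lemma fragment_weight_path_square_le: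
  assumes n: "n \<ge> 1" and C: "C \<ge> 1" and J: "J \<subseteq> path_square n"
  shows "fragment_weight n (C / sqrt n) k J \<le> fact n *
    (\<Sum>A | A \<subseteq> \<Union>J \<and> k < 2 * card A.
      (36 * exp 2 / sqrt C) ^ card A * (1 / sqrt n) ^ card (A - Suc ` A))"
proof -
  define r where "r = sqrt (real n)"
  have r: "r > 0" "r ^ 2 = real n" using n by (auto simp: r_def)
  define g where "g A = fact n * ((9 * exp 2 / sqrt C) ^ card A * (1 / r) ^ card (A - Suc ` A))" for A :: "nat set"
  have g0: "g A \<ge> 0" for A using r C by (auto simp: g_def)
  have JM: "J \<subseteq> complete_edges {1..n}" using J path_square_subset by blast
  have finJ: "finite J" using JM finite_complete_edges by (rule finite_subset) simp
  have finUJ: "finite (\<Union>J)"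
    by (rule finite_subset[of _ "{1..n}"]) (use JM in \<open>auto simp: complete_edges_def\<close>)
  have term_le: "(1 / (C / sqrt n)) ^ card T * real (card (square_copies n T)) \<le> g (anchors T)"
    if T: "T \<subseteq> J" for T
  proof -
    have TL: "T \<subseteq> path_square n" using T J by blast
    define a t s where "a = card (anchors T)" and "t = card T" and "s = card (anchors T - Suc ` anchors T)"
    define deg where "deg = real (card (square_copies n T))"
    have "a \<le> card (\<Union>T)"
      unfolding a_def by (intro card_mono anchors_subset finite_subset[OF Union_mono[OF T] finUJ])
    also have "\<dots> \<le> 2 * t"
      unfolding t_def using T JM by (intro card_Union_complete_edges_le[of "{1..n}"]) auto
    finally have "sqrt C ^ a \<le> sqrt C ^ (2 * t)" using C by (intro power_increasing) auto
    also have "\<dots> = C ^ t" using C by (simp add: power_mult)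
    finally have C1: "sqrt C ^ a \<le> C ^ t" .
    have "r ^ (t + s) \<le> r ^ (2 * a)"
      using card_run_starts_le_anchors[OF TL] n unfolding a_def t_def s_def
      by (intro power_increasing) (auto simp: r_def)
    also have "\<dots> = real n ^ a" using r by (simp add: power_mult)
    finally have r1: "r ^ t * r ^ s \<le> real n ^ a" by (simp add: power_add)
    have "(r ^ t * r ^ s) * sqrt C ^ a * deg \<le> real n ^ a * C ^ t * deg"
      using r1 C1 r C by (intro mult_mono) (auto simp: deg_def)
    also have "\<dots> = C ^ t * (deg * real n ^ a)" by simp
    also have "\<dots> \<le> C ^ t * ((9 * exp 2) ^ a * fact n)"
      using card_square_copies_le[OF TL] C unfolding a_def deg_def by (intro mult_left_mono) auto
    finally have "r ^ t / C ^ t * deg \<le> (9 * exp 2) ^ a * fact n / (sqrt C ^ a * r ^ s)"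
      using r C by (simp add: field_simps)
    then show ?thesis
      unfolding g_def a_def[symmetric] s_def[symmetric] t_def[symmetric] deg_def[symmetric]
      by (simp add: power_divide r_def[symmetric] mult.commute)
  qed
  define TT where "TT = {T. T \<subseteq> J \<and> k < card T}"
  define AA where "AA = {A. A \<subseteq> \<Union>J \<and> k < 2 * card A}"
  have fin: "finite TT" "finite AA" unfolding TT_def AA_def using finJ finUJ by auto
  have TA: "anchors ` TT \<subseteq> AA"
  proof clarify
    fix T assume T: "T \<in> TT"
    then have TJ: "T \<subseteq> J" "k < card T" by (auto simp: TT_def)
    then have "card T \<le> 2 * card (anchors T)"
      using card_run_starts_le_anchors[OF subset_trans[OF TJ(1) J]] by linarith
    moreover have "anchors T \<subseteq> \<Union>J" by (rule order_trans[OF anchors_subset Union_mono[OF TJ(1)]])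
    ultimately show "anchors T \<in> AA" using TJ(2) by (simp add: AA_def)
  qed
  have "fragment_weight n (C / sqrt n) k J \<le> (\<Sum>T\<in>TT. g (anchors T))"
    unfolding fragment_weight_def TT_def by (intro sum_mono term_le) auto
  also have "\<dots> = (\<Sum>A\<in>AA. \<Sum>T | T \<in> TT \<and> anchors T = A. g (anchors T))"
    using fin TA by (intro sum.group[symmetric])
  also have "\<dots> = (\<Sum>A\<in>AA. real (card {T \<in> TT. anchors T = A}) * g A)"
    by (intro sum.cong) auto
  also have "\<dots> \<le> (\<Sum>A\<in>AA. 4 ^ card A * g A)"
  proof (intro sum_mono mult_right_mono g0)
    fix A assume "A \<in> AA"
    then have finA: "finite A" using finUJ by (auto simp: AA_def intro: finite_subset)
    define EA where "EA = (\<Union>i\<in>A. {{i - 1, i}, {i - 2, i}})"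
    have finEA: "finite EA" unfolding EA_def using finA by auto
    have "card EA \<le> (\<Sum>i\<in>A. card {{i - 1, i}, {i - 2, i}})" unfolding EA_def using finA by (rule card_UN_le)
    also have "\<dots> \<le> (\<Sum>i\<in>A. 2)" by (intro sum_mono) (auto simp: card_insert_if)
    finally have "card EA \<le> 2 * card A" by simp
    have "card {T \<in> TT. anchors T = A} \<le> card (Pow EA)"
    proof (rule card_mono)
      show "{T \<in> TT. anchors T = A} \<subseteq> Pow EA"
        using path_square_subset_anchor_edges[of _ n] J unfolding EA_def TT_def by blast
    qed (use finEA in auto)
    also have "\<dots> = 2 ^ card EA" using finEA by (rule card_Pow)
    also have "\<dots> \<le> 2 ^ (2 * card A)" using \<open>card EA \<le> 2 * card A\<close> by (intro power_increasing) auto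
    also have "\<dots> = 4 ^ card A" by (simp add: power_mult)
    finally have "real (card {T \<in> TT. anchors T = A}) \<le> real (4 ^ card A)" by (simp only: of_nat_le_iff)
    then show "real (card {T \<in> TT. anchors T = A}) \<le> 4 ^ card A" by simp
  qed
  also have "\<dots> = fact n * (\<Sum>A\<in>AA. (36 * exp 2 / sqrt C) ^ card A * (1 / sqrt n) ^ card (A - Suc ` A))"
  proof -
    have "4 ^ m * (9 * exp 2 / sqrt C) ^ m = (36 * exp 2 / sqrt C) ^ m" for m
      by (simp add: power_mult_distrib[symmetric])
    then show ?thesis
      unfolding sum_distrib_left g_def r_def by (intro sum.cong) (auto simp: mult.assoc mult.left_commute)
  qed
  finally show ?thesis unfolding AA_def .
qed

text \<open>Of the two factors \<open>z ^ card A\<close>, one is bounded by \<open>z ^ m\<close> and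
  the other one is left for \<open>sum_run_starts_le\<close>.\<close>

lemma sum_run_starts_tail_le:
  fixes y z :: real and X :: "nat set"
  assumes z: "0 \<le> z" "z \<le> 1 / 2" and y: "0 \<le> y" and fin: "finite X"
  shows "(\<Sum>A | A \<subseteq> X \<and> 2 * m < 2 * card A. (z * z) ^ card A * y ^ card (A - Suc ` A))
    \<le> z ^ m * (1 + 2 * z * y) ^ card X"
proof -
  have "(\<Sum>A | A \<subseteq> X \<and> 2 * m < 2 * card A. (z * z) ^ card A * y ^ card (A - Suc ` A)) \<le>
     (\<Sum>A | A \<subseteq> X \<and> 2 * m < 2 * card A. z ^ m * (z ^ card A * y ^ card (A - Suc ` A)))"
  proof (rule sum_mono)
    fix A assume "A \<in> {A. A \<subseteq> X \<and> 2 * m < 2 * card A}"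
    then have "z ^ card A \<le> z ^ m" using z by (intro power_decreasing) auto
    then have "z ^ card A * (z ^ card A * y ^ card (A - Suc ` A)) \<le> z ^ m * (z ^ card A * y ^ card (A - Suc ` A))"
      using z y by (intro mult_right_mono) auto
    then show "(z * z) ^ card A * y ^ card (A - Suc ` A) \<le> z ^ m * (z ^ card A * y ^ card (A - Suc ` A))"
      by (simp add: power_mult_distrib mult.assoc)
  qed
  also have "\<dots> \<le> (\<Sum>A\<in>Pow X. z ^ m * (z ^ card A * y ^ card (A - Suc ` A)))"
    using z y fin by (intro sum_mono2) auto
  also have "\<dots> \<le> z ^ m * (1 + 2 * z * y) ^ card X"
    unfolding sum_distrib_left[symmetric] using sum_run_starts_le[OF z y fin] z by (intro mult_left_mono) auto
  finally show ?thesis .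
qed

lemma sum_run_starts_nonempty_le:
  fixes x y :: real and X :: "nat set"
  assumes x: "0 \<le> x" "x \<le> 1 / 2" and y: "0 \<le> y" and fin: "finite X"
  shows "(\<Sum>A | A \<subseteq> X \<and> 0 < 2 * card A. x ^ card A * y ^ card (A - Suc ` A))
    \<le> (1 + 2 * x * y) ^ card X - 1"
proof -
  have "{A. A \<subseteq> X \<and> 0 < 2 * card A} = Pow X - {{}}"
    using fin by (auto simp: card_gt_0_iff intro: finite_subset)
  then have "(\<Sum>A | A \<subseteq> X \<and> 0 < 2 * card A. x ^ card A * y ^ card (A - Suc ` A)) =
      (\<Sum>A\<in>Pow X. x ^ card A * y ^ card (A - Suc ` A)) - 1"
    using fin by (simp add: sum_diff1)
  then show ?thesis using sum_run_starts_le[OF assms] by simp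
qed

section \<open>Relabelling and rotating fragments\<close>

lemma image_in_cyclic_square_iff:
  assumes \<rho>: "\<rho> permutes {1..n}"
  shows "\<rho> ` e \<in> cyclic_square n \<pi> \<longleftrightarrow> e \<in> cyclic_square n (\<pi> \<circ> \<rho>)"
proof -
  have inj: "inj \<rho>" using \<rho> by (rule permutes_inj)
  have *: "{\<rho> u, \<rho> v} \<in> cyclic_square n \<pi> \<longleftrightarrow> {u, v} \<in> cyclic_square n (\<pi> \<circ> \<rho>)" for u v
    unfolding doubleton_in_cyclic_square_iff using permutes_in_image[OF \<rho>] inj by (auto simp: inj_eq)
  show ?thesis
  proof
    assume "\<rho> ` e \<in> cyclic_square n \<pi>"
    then obtain u v where uv: "\<rho> ` e = {u, v}" unfolding cyclic_square_def by auto
    then have "e = {inv \<rho> u, inv \<rho> v}"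
      using inj by (metis image_empty image_insert image_inv_f_f)
    moreover have "\<rho> (inv \<rho> x) = x" for x using permutes_inverses(1)[OF \<rho>] .
    ultimately show "e \<in> cyclic_square n (\<pi> \<circ> \<rho>)"
      using *[of "inv \<rho> u" "inv \<rho> v"] \<open>\<rho> ` e \<in> _\<close> uv by simp
  next
    assume e: "e \<in> cyclic_square n (\<pi> \<circ> \<rho>)"
    then obtain u v where "e = {u, v}" unfolding cyclic_square_def by auto
    then show "\<rho> ` e \<in> cyclic_square n \<pi>" using * e by auto
  qed
qed

text \<open>Composition with \<open>\<rho>\<close> is a bijection from the copies containing the
  image of \<open>T\<close> to the copies containing \<open>T\<close>.\<close>

lemma fragment_weight_image:
  assumes \<rho>: "\<rho> permutes {1..n}"
  shows "fragment_weight n p k ((`) \<rho> ` J) = fragment_weight n p k J"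
proof -
  have inj: "inj ((`) \<rho>)" by (auto simp: inj_def inj_image_eq_iff[OF permutes_inj[OF \<rho>]])
  have card_T: "card ((`) \<rho> ` T) = card T" for T
    using inj by (intro card_image) (auto intro: inj_on_subset)
  have copies: "card (square_copies n ((`) \<rho> ` T)) = card (square_copies n T)" for T
  proof (rule bij_betw_same_card[of "\<lambda>\<pi>. \<pi> \<circ> \<rho>"], rule bij_betw_byWitness[where f' = "\<lambda>\<pi>. \<pi> \<circ> inv \<rho>"])
    show "\<forall>\<pi>\<in>square_copies n ((`) \<rho> ` T). \<pi> \<circ> \<rho> \<circ> inv \<rho> = \<pi>"
      by (simp add: comp_assoc permutes_inv_o[OF \<rho>])
    show *: "\<forall>\<pi>\<in>square_copies n T. \<pi> \<circ> inv \<rho> \<circ> \<rho> = \<pi>"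
      by (simp add: comp_assoc permutes_inv_o[OF \<rho>])
    show "(\<lambda>\<pi>. \<pi> \<circ> \<rho>) ` square_copies n ((`) \<rho> ` T) \<subseteq> square_copies n T"
      using \<rho> by (auto simp: containing_def image_in_cyclic_square_iff image_subset_iff intro: permutes_compose)
    show "(\<lambda>\<pi>. \<pi> \<circ> inv \<rho>) ` square_copies n T \<subseteq> square_copies n ((`) \<rho> ` T)"
      using \<rho> * by (auto simp: containing_def image_in_cyclic_square_iff image_subset_iff
        intro: permutes_compose permutes_inv)
  qed
  have "{T. T \<subseteq> (`) \<rho> ` J \<and> k < card T} = (\<lambda>T. (`) \<rho> ` T) ` {T. T \<subseteq> J \<and> k < card T}"
    by (auto simp: subset_image_iff card_T)
  moreover have "inj_on (\<lambda>T. (`) \<rho> ` T) {T. T \<subseteq> J \<and> k < card T}"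
    by (simp add: inj_on_def inj_image_eq_iff[OF inj])
  ultimately show ?thesis
    unfolding fragment_weight_def by (simp only: sum.reindex o_def card_T copies)
qed

lemma cyclic_square_id_cases:
  assumes n: "n \<ge> 5" and e: "e \<in> cyclic_square n id"
  shows "e \<in> path_square n \<or> e \<in> {{1, n}, {1, n - 1}, {2, n}}"
proof -
  obtain i j where ij: "e = {i, j}" "i \<in> {1..n}" "j \<in> {1..n}" "i < j" "near n 2 i j"
  proof -
    obtain u v where uv: "e = {u, v}" "u \<in> {1..n}" "v \<in> {1..n}" "u \<noteq> v" "near n 2 u v"
      using e unfolding cyclic_square_def by auto
    show thesis
    proof (cases "u < v")
      case True
      then show ?thesis using that uv by blast
    next
      case False
      then show ?thesis using that[of v u] uv near_sym by (auto simp: insert_commute)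
    qed
  qed
  then obtain d m where d: "\<bar>d\<bar> \<le> 2" "int j - int i - d = int n * m" by (auto simp: near_def dvd_def)
  \<comment> \<open>Since \<open>1 \<le> j - i < n\<close> and \<open>\<bar>d\<bar> \<le> 2\<close>,
    the multiple of \<open>n\<close> is 0 or 1: no wrap gives an edge of the path, one wrap an edge
    across the end.\<close>
  have "int n * m < int n * 2" "int n * (- 1) < int n * m"
    unfolding d(2)[symmetric] using d(1) ij n by auto
  then have "m < 2" "- 1 < m" using n by (simp_all only: mult_less_cancel_left_pos of_nat_0_less_iff)
  then have "m = 0 \<or> m = 1" by auto
  then show ?thesis
  proof
    assume "m = 0"
    then have "j \<le> i + 2" using d by auto
    then show ?thesis using ij unfolding path_square_def by auto
  next
    assume "m = 1"
    then have "j \<ge> i + n - 2" using d by auto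
    then have "(i = 1 \<and> j = n) \<or> (i = 1 \<and> j = n - 1) \<or> (i = 2 \<and> j = n)" using ij n by auto
    then show ?thesis using ij by auto
  qed
qed

text \<open>The edges of \<open>J\<close> meet at most \<open>2 * card J\<close> vertices, and for
  each vertex at most two of the \<open>n\<close> rotations place it at \<open>n - 1\<close> or
  \<open>n\<close>. As \<open>4 * card J < n\<close>, some rotation keeps both positions free, and
  every edge across the end would use one of them.\<close>

lemma exists_rotation_into_path_square:
  assumes n: "n \<ge> 5" and J: "J \<subseteq> cyclic_square n id" and small: "4 * card J < n"
  shows "\<exists>\<rho>. \<rho> permutes {1..n} \<and> (`) \<rho> ` J \<subseteq> path_square n"
proof -
  define \<rho> where "\<rho> s u = (if u \<in> {1..n} then (u - 1 + s) mod n + 1 else u)" for s u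
  have \<rho>_range: "\<rho> s u \<in> {1..n}" if "u \<in> {1..n}" for s u
  proof -
    have "(u - 1 + s) mod n < n" using n by simp
    then have "(u - 1 + s) mod n + 1 \<in> {1..n}" unfolding atLeastAtMost_iff by linarith
    then show ?thesis unfolding \<rho>_def by (simp only: that if_True)
  qed
  have dvd: "int n dvd int (\<rho> s u) - int u - int s" if "u \<in> {1..n}" for s u
  proof -
    have "int (\<rho> s u) = int (u - 1 + s) mod int n + 1"
      unfolding \<rho>_def by (simp only: that if_True of_nat_add of_nat_mod of_nat_1)
    also have "int (u - 1 + s) = int u - 1 + int s" using that by (simp add: of_nat_diff)
    finally have "int (\<rho> s u) = (int u - 1 + int s) mod int n + 1" .
    moreover have "int n dvd (int u - 1 + int s) mod int n - (int u - 1 + int s)"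
      by (metis mod_eq_dvd_iff mod_mod_trivial)
    ultimately show ?thesis by (simp add: algebra_simps)
  qed
  have eqI: "a = b" if "int n dvd int a - int b" "a < b + n" "b < a + n" for a b
  proof -
    have "\<bar>int a - int b\<bar> < int n" using that by auto
    then have "int a - int b = 0"
      using dvd_imp_le_int[of "int a - int b" "int n"] that(1) by linarith
    then show ?thesis by simp
  qed
  have perm: "\<rho> s permutes {1..n}" for s
  proof (rule bij_imp_permutes)
    have "inj_on (\<rho> s) {1..n}"
    proof (rule inj_onI)
      fix u v assume uv: "u \<in> {1..n}" "v \<in> {1..n}" "\<rho> s u = \<rho> s v"
      have "int n dvd (int (\<rho> s v) - int v - int s) - (int (\<rho> s u) - int u - int s)"
        using uv by (intro dvd_diff dvd)
      then have "int n dvd int u - int v" using uv by (simp add: algebra_simps)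
      then show "u = v" using uv by (intro eqI) auto
    qed
    moreover have "\<rho> s ` {1..n} \<subseteq> {1..n}" using \<rho>_range by blast
    ultimately show "bij_betw (\<rho> s) {1..n} {1..n}"
      by (simp add: bij_betw_def endo_inj_surj)
  qed (auto simp: \<rho>_def)
  have JM: "J \<subseteq> complete_edges {1..n}" using J cyclic_square_subset by blast
  have UJ: "\<Union>J \<subseteq> {1..n}" using JM by (auto simp: complete_edges_def)
  define bad where "bad u = {s \<in> {..<n}. \<rho> s u \<in> {n - 1, n}}" for u
  have card_bad: "card (bad u) \<le> 2" if "u \<in> {1..n}" for u
  proof -
    have "card (bad u) \<le> card {n - 1, n}"
    proof (rule card_inj_on_le[where f = "\<lambda>s. \<rho> s u"])
      show "inj_on (\<lambda>s. \<rho> s u) (bad u)"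
      proof (rule inj_onI)
        fix s t assume st: "s \<in> bad u" "t \<in> bad u" "\<rho> s u = \<rho> t u"
        have "int n dvd (int (\<rho> t u) - int u - int t) - (int (\<rho> s u) - int u - int s)"
          using that by (intro dvd_diff dvd)
        then have "int n dvd int s - int t" using st by (simp add: algebra_simps)
        then show "s = t" using st by (intro eqI) (auto simp: bad_def)
      qed
    qed (auto simp: bad_def)
    also have "\<dots> \<le> 2" by (simp add: card_insert_if)
    finally show ?thesis .
  qed
  have "card (\<Union>u\<in>\<Union>J. bad u) \<le> (\<Sum>u\<in>\<Union>J. card (bad u))"
    using UJ by (intro card_UN_le) (auto intro: finite_subset)
  also have "\<dots> \<le> (\<Sum>u\<in>\<Union>J. 2)" using UJ card_bad by (intro sum_mono) blast
  also have "\<dots> \<le> 4 * card J" using card_Union_complete_edges_le[OF _ JM] by simp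
  also have "\<dots> < card {..<n}" using small by simp
  finally have less: "card (\<Union>u\<in>\<Union>J. bad u) < card {..<n}" .
  have "\<not> {..<n} \<subseteq> (\<Union>u\<in>\<Union>J. bad u)"
  proof
    assume "{..<n} \<subseteq> (\<Union>u\<in>\<Union>J. bad u)"
    moreover have "finite (\<Union>u\<in>\<Union>J. bad u)"
      by (rule finite_subset[of _ "{..<n}"]) (auto simp: bad_def)
    ultimately have "card {..<n} \<le> card (\<Union>u\<in>\<Union>J. bad u)" by (intro card_mono)
    with less show False by simp
  qed
  then obtain s where s: "s < n" "\<And>u. u \<in> \<Union>J \<Longrightarrow> \<rho> s u \<notin> {n - 1, n}" unfolding bad_def by blast
  have "\<rho> s ` e \<in> path_square n" if e: "e \<in> J" for e
  proof -
    obtain u v where uv: "e = {u, v}" "u \<in> {1..n}" "v \<in> {1..n}" "u \<noteq> v" "near n 2 u v"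
      using e J unfolding cyclic_square_def by auto
    have "near n 2 (\<rho> s u) (\<rho> s v)"
    proof -
      obtain d where d: "\<bar>d\<bar> \<le> 2" "int n dvd int v - int u - d" using uv(5) by (auto simp: near_def)
      have "int n dvd (int v - int u - d) + ((int (\<rho> s v) - int v - int s) - (int (\<rho> s u) - int u - int s))"
        by (rule dvd_add[OF d(2) dvd_diff[OF dvd[OF uv(3)] dvd[OF uv(2)]]])
      also have "\<dots> = int (\<rho> s v) - int (\<rho> s u) - d" by simp
      finally show ?thesis using d(1) unfolding near_def by (intro exI[of _ d] conjI) auto
    qed
    then have "\<rho> s ` e \<in> cyclic_square n id"
      using uv image_in_cyclic_square_iff[OF perm, of s e id]
      by (simp add: doubleton_in_cyclic_square_iff)
    moreover have "n \<notin> \<rho> s ` e" "n - 1 \<notin> \<rho> s ` e"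
      using s(2)[of u, OF UnionI[OF e]] s(2)[of v, OF UnionI[OF e]] uv(1) by auto
    then have "\<rho> s ` e \<notin> {{1, n}, {1, n - 1}, {2, n}}" by auto
    ultimately show ?thesis using cyclic_square_id_cases[OF n] by blast
  qed
  then show ?thesis using perm by blast
qed

lemma exists_copy_in_path_square:
  assumes n: "n \<ge> 5" and \<tau>: "\<tau> permutes {1..n}" and J: "J \<subseteq> cyclic_square n \<tau>" and small: "4 * card J < n"
  shows "\<exists>J'\<subseteq>path_square n. card J' = card J \<and> (\<forall>p k. fragment_weight n p k J = fragment_weight n p k J')"
proof -
  have inj: "inj_on ((`) \<rho>) B" if "\<rho> permutes {1..n}" for \<rho> :: "nat \<Rightarrow> nat" and B
    using permutes_inj[OF that] by (auto simp: inj_on_def inj_image_eq_iff)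
  have "(`) \<tau> ` J \<subseteq> cyclic_square n id"
    using J image_in_cyclic_square_iff[OF \<tau>, of _ id] by auto
  moreover have card1: "card ((`) \<tau> ` J) = card J" using inj[OF \<tau>] by (rule card_image)
  ultimately obtain \<rho> where \<rho>: "\<rho> permutes {1..n}" "(`) \<rho> ` (`) \<tau> ` J \<subseteq> path_square n"
    using exists_rotation_into_path_square[OF n] small by metis
  have "card ((`) \<rho> ` (`) \<tau> ` J) = card J" using card_image[OF inj[OF \<rho>(1)]] card1 by simp
  then show ?thesis using \<rho> by (intro exI[of _ "(`) \<rho> ` (`) \<tau> ` J"]) (simp add: fragment_weight_image[OF \<rho>(1)] fragment_weight_image[OF \<tau>])
qed

text \<open>The edges across the end of the path cost a factor polynomial in \<open>n\<close>, which is affordable only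
  for fragments of size of order \<open>sqrt n\<close>. Smaller sets \<open>J\<close> can be rotated into the path instead.\<close>

lemma fragment_weight_wrap_le:
  assumes n: "n \<ge> 5" and p: "0 < p" "p \<le> 1" and J: "J \<subseteq> cyclic_square n id"
  shows "fragment_weight n p (k + 3) J \<le> 8 * (1 / p) ^ 3 * fragment_weight n p k (J \<inter> path_square n)"
proof -
  define L where "L = path_square n"
  define Q where "Q = {{1, n}, {1, n - 1}, {2, n}}"
  have finJ: "finite J" using J cyclic_square_subset finite_complete_edges
    by (meson finite_atLeastAtMost finite_subset)
  have finQ: "finite Q" and cardQ: "card Q \<le> 3" unfolding Q_def by (auto simp: card_insert_if)
  define f where "f T = (1 / p) ^ card T * real (card (square_copies n T))" for T
  have f0: "f T \<ge> 0" for T using p by (simp add: f_def)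
  have "fragment_weight n p (k + 3) J = (\<Sum>T | T \<subseteq> J \<and> k + 3 < card T. f T)"
    by (simp add: fragment_weight_def f_def)
  \<comment> \<open>Every \<open>T\<close> is split into its part in the path and at most three
    edges of \<open>Q\<close>; those cost a factor of at most \<open>(1 / p) ^ 3\<close>, and there
    are at most \<open>2 ^ 3\<close> choices for them.\<close>
  also have "\<dots> \<le> (\<Sum>(T, R)\<in>{T. T \<subseteq> J \<inter> L \<and> k < card T} \<times> Pow Q. (1 / p) ^ 3 * f T)"
  proof (rule sum_le_included[where i = "\<lambda>(T, R). T \<union> R"])
    show "\<forall>T\<in>{T. T \<subseteq> J \<and> k + 3 < card T}.
      \<exists>y\<in>{T. T \<subseteq> J \<inter> L \<and> k < card T} \<times> Pow Q. (case y of (T, R) \<Rightarrow> T \<union> R) = T \<and>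
        f T \<le> (case y of (T, R) \<Rightarrow> (1 / p) ^ 3 * f T)"
    proof clarify
      fix T assume T: "T \<subseteq> J" "k + 3 < card T"
      have finT: "finite T" using T finJ finite_subset by blast
      have TQ: "T - L \<subseteq> Q" using T J cyclic_square_id_cases[OF n] unfolding L_def Q_def by blast
      then have "card (T - L) \<le> 3" using card_mono[OF finQ] cardQ le_trans by blast
      moreover have "card T = card (T \<inter> L) + card (T - L)" using finT by (rule card_Int_Diff)
      ultimately have le: "card T \<le> 3 + card (T \<inter> L)" by linarith
      have "card (square_copies n T) \<le> card (square_copies n (T \<inter> L))"
        by (intro card_mono finite_square_copies) (auto simp: containing_def)
      then have "f T \<le> (1 / p) ^ (3 + card (T \<inter> L)) * real (card (square_copies n (T \<inter> L)))"
        unfolding f_def using le p by (intro mult_mono power_increasing) auto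
      also have "\<dots> = (1 / p) ^ 3 * f (T \<inter> L)" by (simp add: f_def power_add)
      finally have "f T \<le> (1 / p) ^ 3 * f (T \<inter> L)" .
      moreover have "(T \<inter> L, T - L) \<in> {T. T \<subseteq> J \<inter> L \<and> k < card T} \<times> Pow Q" using T TQ le by auto
      ultimately show "\<exists>y\<in>{T. T \<subseteq> J \<inter> L \<and> k < card T} \<times> Pow Q. (case y of (T, R) \<Rightarrow> T \<union> R) = T \<and>
        f T \<le> (case y of (T, R) \<Rightarrow> (1 / p) ^ 3 * f T)"
        by (intro bexI[of _ "(T \<inter> L, T - L)"]) auto
    qed
  qed (use finJ finQ f0 p in auto)
  also have "\<dots> = real (card (Pow Q)) * ((1 / p) ^ 3 * (\<Sum>T | T \<subseteq> J \<inter> L \<and> k < card T. f T))"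
    by (simp add: sum.cartesian_product[symmetric] sum_distrib_left algebra_simps)
  also have "\<dots> \<le> 8 * ((1 / p) ^ 3 * (\<Sum>T | T \<subseteq> J \<inter> L \<and> k < card T. f T))"
  proof (rule mult_right_mono)
    have "(2::real) ^ card Q \<le> 2 ^ 3" using cardQ by (rule power_increasing) simp
    then show "real (card (Pow Q)) \<le> 8" using finQ by (simp add: card_Pow)
  qed (use f0 p in \<open>auto intro!: mult_nonneg_nonneg sum_nonneg\<close>)
  finally show ?thesis by (simp add: fragment_weight_def f_def L_def)
qed

section \<open>The three rounds\<close>

text \<open>Successive vertices of the cycle have visiting times at cyclic distance at most 1, so a
  walk with at most two edges stays within 2.\<close>

lemma contains_square_hamilton_cycleI:
  assumes n: "n \<ge> 3" and \<pi>: "\<pi> permutes {1..n}" and E: "cyclic_square n \<pi> \<subseteq> E"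
  shows "contains_square_hamilton_cycle {1..n} E"
proof -
  define vs where "vs = map (\<lambda>i. inv \<pi> (Suc i)) [0..<n]"
  have len: "length vs = n" by (simp add: vs_def)
  have nth: "vs ! i = inv \<pi> (Suc i)" if "i < n" for i using that by (simp add: vs_def)
  have inv: "inv \<pi> permutes {1..n}" using \<pi> by (rule permutes_inv)
  have \<pi>_inv: "\<pi> (inv \<pi> x) = x" for x using permutes_inverses(1)[OF \<pi>] .
  define C where "C = {{vs ! i, vs ! ((i + 1) mod length vs)} | i. i < length vs}"
  have "distinct vs"
    unfolding vs_def by (auto simp: distinct_map intro!: inj_onI dest: injD[OF permutes_inj[OF inv]])
  moreover have "set vs = {1..n}"
  proof -
    have "set vs = inv \<pi> ` (Suc ` {0..<n})" by (simp only: vs_def set_map set_upt image_image)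
    also have "Suc ` {0..<n} = {1..n}" by (auto simp: image_Suc_atLeastLessThan)
    also have "inv \<pi> ` {1..n} = {1..n}" using inv by (rule permutes_image)
    finally show ?thesis .
  qed
  ultimately have cycle: "hamilton_cycle {1..n} C"
    unfolding hamilton_cycle_def C_def using n len by (intro exI[of _ vs]) auto
  have step: "near n 1 (\<pi> x) (\<pi> y)" if xy: "{x, y} \<in> C" for x y
  proof -
    obtain i where i: "i < n" "{x, y} = {vs ! i, vs ! (Suc i mod n)}"
      using xy unfolding C_def len Suc_eq_plus1 by blast
    have "Suc i mod n < n" using n by simp
    note i = i(1) i(2)[unfolded nth[OF i(1)] nth[OF this]]
    have "near n 1 (Suc i) (Suc (Suc i mod n))"
    proof (cases "Suc i = n")
      case True
      then show ?thesis unfolding near_def by (intro exI[of _ 1]) auto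
    next
      case False
      then show ?thesis using i unfolding near_def by (intro exI[of _ 1]) auto
    qed
    with i(2) show ?thesis by (auto simp: doubleton_eq_iff \<pi>_inv intro: near_sym)
  qed
  have "graph_square {1..n} C \<subseteq> cyclic_square n \<pi>"
  proof
    fix e assume "e \<in> graph_square {1..n} C"
    then obtain u v where e: "e = {u, v}" "u \<in> {1..n}" "v \<in> {1..n}" "u \<noteq> v" "graph_dist C u v \<le> 2"
      unfolding graph_square_def by auto
    \<comment> \<open>The strict bound lets \<open>Inf_less_iff\<close> provide an actual walk with
      at most two edges.\<close>
    have "(2 :: enat) < 3" by simp
    with e(5) have "graph_dist C u v < 3" by (rule order_le_less_trans)
    then obtain xs where xs: "walk_between C u xs v" "enat (length xs - 1) < 3"
      unfolding graph_dist_def Inf_less_iff by auto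
    then have "length xs \<le> 3" by (simp add: numeral_eq_enat)
    moreover have "xs \<noteq> []" using xs by (simp add: walk_between_def)
    ultimately consider a where "xs = [a]" | a b where "xs = [a, b]" | a b c where "xs = [a, b, c]"
      by (cases xs rule: remdups_adj.cases; cases "tl (tl xs)"; auto)
    then have "near n 2 (\<pi> u) (\<pi> v)"
    proof cases
      case 1
      then show ?thesis using xs by (auto simp: walk_between_def intro: near_refl)
    next
      case 2
      then have "near n 1 (\<pi> u) (\<pi> v)" using xs by (auto simp: walk_between_def intro: step[unfolded One_nat_def])
      then show ?thesis by (rule near_mono) simp
    next
      case 3
      then have "near n (1 + 1) (\<pi> u) (\<pi> v)"
        using xs by (intro near_trans[of n 1 _ "\<pi> b" 1]) (auto simp: walk_between_def intro: step[unfolded One_nat_def])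
      then show ?thesis by (simp add: numeral_2_eq_2)
    qed
    then show "e \<in> cyclic_square n \<pi>" using e by (auto simp: doubleton_in_cyclic_square_iff)
  qed
  then show ?thesis unfolding contains_square_hamilton_cycle_def using cycle E by blast
qed

text \<open>Here \<open>576 = 36 * 16\<close>: the base \<open>36 * exp 2 / sqrt C\<close> in
  \<open>fragment_weight_path_square_le\<close> becomes \<open>1 / 16 = (1 / 4) ^ 2\<close>, which
  suits \<open>sum_run_starts_tail_le\<close> with \<open>z = 1 / 4\<close>.\<close>

definition density_const :: real where
  "density_const = (576 * exp 2) ^ 2"

lemma density_const: "density_const \<ge> 1" "36 * exp 2 / sqrt density_const = 1 / 16"
proof -
  have "(576 * exp 2 :: real) \<ge> 1" using one_le_exp_iff[of "2::real"] by linarith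
  then show "density_const \<ge> 1" unfolding density_const_def by (rule one_le_power)
  have "sqrt density_const = 576 * exp 2" unfolding density_const_def by (subst real_sqrt_abs) simp
  then show "36 * exp 2 / sqrt density_const = 1 / 16" by simp
qed

lemma fragment_weight_path_square_tail_le:
  assumes n: "n \<ge> 1" and J: "J \<subseteq> path_square n" and N: "card (\<Union>J) \<le> N"
  shows "fragment_weight n (density_const / sqrt n) (2 * m) J \<le>
    fact n * ((1 / 4) ^ m * (1 + 1 / (2 * sqrt n)) ^ N)"
proof -
  have finUJ: "finite (\<Union>J)"
    by (rule finite_subset[of _ "{1..n}"]) (use J path_square_subset in \<open>auto simp: complete_edges_def\<close>)
  have "fragment_weight n (density_const / sqrt n) (2 * m) J \<le> fact n *
    (\<Sum>A | A \<subseteq> \<Union>J \<and> 2 * m < 2 * card A. (1 / 4 * (1 / 4)) ^ card A * (1 / sqrt n) ^ card (A - Suc ` A))"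
    using fragment_weight_path_square_le[OF n density_const(1) J, of "2 * m"] by (simp add: density_const(2))
  also have "\<dots> \<le> fact n * ((1 / 4) ^ m * (1 + 2 * (1 / 4) * (1 / sqrt n)) ^ card (\<Union>J))"
    using finUJ by (intro mult_left_mono sum_run_starts_tail_le) auto
  also have "\<dots> \<le> fact n * ((1 / 4) ^ m * (1 + 2 * (1 / 4) * (1 / sqrt n)) ^ N)"
    using N by (intro mult_left_mono power_increasing) auto
  finally show ?thesis by simp
qed

text \<open>The factor \<open>(1 + 1 / (2 * sqrt n)) ^ n\<close> is at most
  \<open>exp (sqrt n / 2)\<close>; it and the polynomial cost of the edges across the end are
  outweighed by \<open>(1 / 4) ^ m\<close> once \<open>m\<close> is close to
  \<open>sqrt n\<close>.\<close>

lemma fragment_weight_first_round: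
  assumes n: "n \<ge> 5" and p: "density_const / sqrt n \<le> 1"
    and \<tau>: "\<tau> permutes {1..n}" and J: "J \<subseteq> cyclic_square n \<tau>"
  shows "fragment_weight n (density_const / sqrt n) (2 * m + 3) J \<le>
    fact n * (8 * sqrt n ^ 3 * ((1 / 4) ^ m * (1 + 1 / (2 * sqrt n)) ^ n))"
proof -
  define p where "p = density_const / sqrt n"
  have p01: "0 < p" "p \<le> 1" using p n density_const(1) by (auto simp: p_def)
  define J' where "J' = (`) \<tau> ` J"
  have J': "J' \<subseteq> cyclic_square n id"
    using J image_in_cyclic_square_iff[OF \<tau>, of _ id] by (auto simp: J'_def)
  have "\<Union>(J' \<inter> path_square n) \<subseteq> {1..n}"
    using path_square_subset[of n] by (auto simp: complete_edges_def)
  then have N: "card (\<Union>(J' \<inter> path_square n)) \<le> n" using card_mono[of "{1..n}"] by fastforce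
  have "1 / p \<le> sqrt n" using n density_const(1) by (simp add: p_def field_simps)
  then have p3: "(1 / p) ^ 3 \<le> sqrt n ^ 3" using p01 by (intro power_mono) auto
  have "fragment_weight n p (2 * m + 3) J = fragment_weight n p (2 * m + 3) J'"
    unfolding J'_def by (rule fragment_weight_image[OF \<tau>, symmetric])
  also have "\<dots> \<le> 8 * (1 / p) ^ 3 * fragment_weight n p (2 * m) (J' \<inter> path_square n)"
    using n p01 J' by (rule fragment_weight_wrap_le)
  also have "\<dots> \<le> 8 * sqrt n ^ 3 * (fact n * ((1 / 4) ^ m * (1 + 1 / (2 * sqrt n)) ^ n))"
  proof (rule mult_mono)
    show "fragment_weight n p (2 * m) (J' \<inter> path_square n) \<le> fact n * ((1 / 4) ^ m * (1 + 1 / (2 * sqrt n)) ^ n)"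
      unfolding p_def using n N by (intro fragment_weight_path_square_tail_le) auto
    show "0 \<le> fragment_weight n p (2 * m) (J' \<inter> path_square n)"
      unfolding fragment_weight_def using p01 by (intro sum_nonneg) auto
  qed (use p3 in auto)
  finally show ?thesis unfolding p_def by (simp add: mult.left_commute)
qed

text \<open>The set \<open>J\<close> now meets at most \<open>2 * k\<close> vertices. With
  \<open>k\<close> of order \<open>sqrt n\<close> the last factor is bounded, so any
  \<open>m\<close> tending to infinity suffices.\<close>

lemma fragment_weight_second_round:
  assumes n: "n \<ge> 5" and \<tau>: "\<tau> permutes {1..n}" and J: "J \<subseteq> cyclic_square n \<tau>"
    and k: "card J \<le> k" "4 * k < n"
  shows "fragment_weight n (density_const / sqrt n) (2 * m) J \<le>
    fact n * ((1 / 4) ^ m * (1 + 1 / (2 * sqrt n)) ^ (2 * k))"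
proof -
  obtain J' where J': "J' \<subseteq> path_square n" "card J' = card J"
    "\<And>p k. fragment_weight n p k J = fragment_weight n p k J'"
    using exists_copy_in_path_square[OF n \<tau> J] k by auto
  have "card (\<Union>J') \<le> 2 * k"
    using card_Union_complete_edges_le[OF _ order_trans[OF J'(1) path_square_subset]] J'(2) k by simp
  then show ?thesis unfolding J'(3) using n J'(1) by (intro fragment_weight_path_square_tail_le) auto
qed

text \<open>All nonempty fragments count here, so the sum runs over nonempty sets of anchors, hence
  the \<open>- 1\<close>. The factor after \<open>fact n\<close> tends to 0 if \<open>k\<close> is
  of smaller order than \<open>sqrt n\<close>.\<close>

lemma fragment_weight_third_round:
  assumes n: "n \<ge> 5" and \<tau>: "\<tau> permutes {1..n}" and J: "J \<subseteq> cyclic_square n \<tau>"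
    and k: "card J \<le> k" "4 * k < n"
  shows "fragment_weight n (density_const / sqrt n) 0 J \<le> fact n * ((1 + 1 / (8 * sqrt n)) ^ (2 * k) - 1)"
proof -
  obtain J' where J': "J' \<subseteq> path_square n" "card J' = card J"
    "\<And>p k. fragment_weight n p k J = fragment_weight n p k J'"
    using exists_copy_in_path_square[OF n \<tau> J] k by auto
  have N: "card (\<Union>J') \<le> 2 * k"
    using card_Union_complete_edges_le[OF _ order_trans[OF J'(1) path_square_subset]] J'(2) k by simp
  have finUJ: "finite (\<Union>J')"
    by (rule finite_subset[of _ "{1..n}"])
      (use order_trans[OF J'(1) path_square_subset] in \<open>auto simp: complete_edges_def\<close>)
  have "fragment_weight n (density_const / sqrt n) 0 J' \<le> fact n *
    (\<Sum>A | A \<subseteq> \<Union>J' \<and> 0 < 2 * card A. (1 / 16) ^ card A * (1 / sqrt n) ^ card (A - Suc ` A))"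
    using fragment_weight_path_square_le[OF _ density_const(1) J'(1), of 0] n
    unfolding density_const(2) by simp
  also have "\<dots> \<le> fact n * ((1 + 2 * (1 / 16) * (1 / sqrt n)) ^ card (\<Union>J') - 1)"
    using finUJ by (intro mult_left_mono sum_run_starts_nonempty_le) auto
  also have "\<dots> \<le> fact n * ((1 + 2 * (1 / 16) * (1 / sqrt n)) ^ (2 * k) - 1)"
    using N by (intro mult_left_mono diff_right_mono power_increasing) auto
  finally show ?thesis unfolding J'(3) by simp
qed

text \<open>The rounds are assembled backwards, from the last to the first. The family size required
  by \<open>fragment_cover\<close> doubles each time, from \<open>fact n / 8\<close> to
  \<open>fact n\<close>, the number of all permutations. Before doubling, these sizes contribute the
  factors 8, 4 and 2 to the error terms of the third, second and first round.\<close>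

lemma prob_no_square_hamilton_cycle_le:
  fixes n m1 m2 :: nat and p :: real
  assumes n: "n \<ge> 5" and c: "density_const / sqrt n < 1"
    and p: "3 * (density_const / sqrt n) \<le> p" "p \<le> 1"
    and m1: "4 * (2 * m1 + 3) < n" and m2: "8 * m2 < n"
  shows "1 - measure_pmf.prob (binomial_random_graph n p) {E. contains_square_hamilton_cycle {1..n} E} \<le>
    16 * sqrt n ^ 3 * ((1 / 4) ^ m1 * (1 + 1 / (2 * sqrt n)) ^ n) +
    4 * ((1 / 4) ^ m2 * (1 + 1 / (2 * sqrt n)) ^ (2 * (2 * m1 + 3))) +
    8 * ((1 + 1 / (8 * sqrt n)) ^ (2 * (2 * m2)) - 1)" (is "_ \<le> ?\<epsilon>1 + ?\<epsilon>2 + ?\<epsilon>3")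
proof -
  define c where "c = density_const / sqrt n"
  have c01: "0 < c" "c < 1" using c n density_const(1) by (auto simp: c_def)
  define M where "M = complete_edges {1..n}"
  define H where "H = {\<pi>. \<pi> permutes {1..n}}"
  define S where "S = cyclic_square n"
  have finM: "finite M" unfolding M_def by (simp add: finite_complete_edges)
  have finH: "finite H" unfolding H_def by (simp add: finite_permutations)
  have SM: "S i \<subseteq> M" for i unfolding S_def M_def by (rule cyclic_square_subset)
  have cardH: "card H = fact n" unfolding H_def by (simp add: card_permutations)
  \<comment> \<open>The density left over when three rounds of density \<open>c\<close> are taken
    out of \<open>p\<close>; Bernoulli's inequality makes it nonnegative.\<close>
  define q0 where "q0 = 1 - (1 - p) / (1 - c) ^ 3"
  define q1 where "q1 = c + q0 - c * q0"
  define q2 where "q2 = c + q1 - c * q1"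
  have "1 - p \<le> 1 - 3 * c" using p by (simp add: c_def)
  also have "\<dots> \<le> (1 - c) ^ 3" using Bernoulli_inequality[of "- c" 3] c01 by simp
  finally have q0: "0 \<le> q0" "q0 \<le> 1" using p c01 by (auto simp: q0_def)
  have conv: "0 \<le> c + q - c * q \<and> c + q - c * q \<le> 1" if "0 \<le> q" "q \<le> 1" for q
  proof -
    have "(1 - c) * (1 - q) \<ge> 0" "c * (1 - q) \<ge> 0" using that c01 by auto
    then show ?thesis using that by (simp add: algebra_simps)
  qed
  have q1: "0 \<le> q1" "q1 \<le> 1" using conv[OF q0] by (auto simp: q1_def)
  have q2: "0 \<le> q2" "q2 \<le> 1" using conv[OF q1] by (auto simp: q2_def)
  have "1 - (c + q2 - c * q2) = (1 - c) ^ 3 * (1 - q0)"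
    unfolding q2_def q1_def by (simp add: algebra_simps power3_eq_cube)
  also have "\<dots> = 1 - p" using c01 by (simp add: q0_def)
  finally have q3: "c + q2 - c * q2 = p" by simp
  have weight: "(\<Sum>T | T \<subseteq> J \<and> k' < card T. (1 / c) ^ card T * real (card (containing H S T))) =
      fragment_weight n (density_const / sqrt n) k' J" for J k'
    by (simp add: fragment_weight_def c_def H_def S_def)
  have \<epsilon>: "0 \<le> ?\<epsilon>2" "0 \<le> ?\<epsilon>3" by (auto intro!: mult_nonneg_nonneg one_le_power)
  have cover0: "fragment_cover M H S (fact n / 8) 0 q0 0"
    using finM SM by (intro fragment_cover_base) auto
  have m2': "4 * (2 * m2) < n" using m2 by simp
  have "fragment_cover M H S (2 * (fact n / 8)) (2 * m2) (c + q0 - c * q0) (0 + ?\<epsilon>3)"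
  proof (rule fragment_cover_step[where k' = "0"])
    show "fragment_cover M H S (fact n / 8) 0 q0 0" by (fact cover0)
    fix i J assume i: "i \<in> H" "J \<subseteq> S i" "card J \<le> 2 * m2"
    have "fragment_weight n (density_const / sqrt n) 0 J \<le> fact n * ((1 + 1 / (8 * sqrt n)) ^ (2 * (2 * m2)) - 1)"
      using fragment_weight_third_round[OF n _ _ _ m2', of i J] i by (simp only: H_def S_def mem_Collect_eq)
    also have "\<dots> = ?\<epsilon>3 * (fact n / 8)" by simp
    finally show "(\<Sum>T | T \<subseteq> J \<and> 0 < card T. (1 / c) ^ card T * real (card (containing H S T))) \<le> ?\<epsilon>3 * (fact n / 8)"
      unfolding weight .
  qed (use finM finH SM c01 q0 \<epsilon> in \<open>simp_all del: of_nat_mult\<close>)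
  then have cover1: "fragment_cover M H S (fact n / 4) (2 * m2) q1 ?\<epsilon>3" unfolding q1_def by simp
  have "fragment_cover M H S (2 * (fact n / 4)) (2 * m1 + 3) (c + q1 - c * q1) (?\<epsilon>3 + ?\<epsilon>2)"
  proof (rule fragment_cover_step[where k' = "2 * m2"])
    show "fragment_cover M H S (fact n / 4) (2 * m2) q1 (?\<epsilon>3)" by (fact cover1)
    fix i J assume i: "i \<in> H" "J \<subseteq> S i" "card J \<le> 2 * m1 + 3"
    have "fragment_weight n (density_const / sqrt n) (2 * m2) J \<le> fact n * ((1 / 4) ^ m2 * (1 + 1 / (2 * sqrt n)) ^ (2 * (2 * m1 + 3)))"
      using fragment_weight_second_round[OF n _ _ _ m1, of i J m2] i by (simp only: H_def S_def mem_Collect_eq)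
    also have "\<dots> = ?\<epsilon>2 * (fact n / 4)" by simp
    finally show "(\<Sum>T | T \<subseteq> J \<and> 2 * m2 < card T. (1 / c) ^ card T * real (card (containing H S T))) \<le> ?\<epsilon>2 * (fact n / 4)"
      unfolding weight .
  qed (use finM finH SM c01 q1 \<epsilon> in \<open>simp_all del: of_nat_mult\<close>)
  then have cover2: "fragment_cover M H S (fact n / 2) (2 * m1 + 3) q2 (?\<epsilon>3 + ?\<epsilon>2)" unfolding q2_def by simp
  \<comment> \<open>The bound \<open>card M\<close> does not restrict the fragments, so the first
    round can start with whole squares.\<close>
  have "fragment_cover M H S (2 * (fact n / 2)) (card M) (c + q2 - c * q2) (?\<epsilon>3 + ?\<epsilon>2 + ?\<epsilon>1)"
  proof (rule fragment_cover_step[where k' = "2 * m1 + 3"])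
    show "fragment_cover M H S (fact n / 2) (2 * m1 + 3) q2 (?\<epsilon>3 + ?\<epsilon>2)" by (fact cover2)
    fix i J assume i: "i \<in> H" "J \<subseteq> S i" "card J \<le> card M"
    have "fragment_weight n (density_const / sqrt n) (2 * m1 + 3) J \<le> fact n * (8 * sqrt n ^ 3 * ((1 / 4) ^ m1 * (1 + 1 / (2 * sqrt n)) ^ n))"
      using fragment_weight_first_round[OF n less_imp_le[OF c], of i J m1] i by (simp only: H_def S_def mem_Collect_eq)
    also have "\<dots> = ?\<epsilon>1 * (fact n / 2)" by simp
    finally show "(\<Sum>T | T \<subseteq> J \<and> 2 * m1 + 3 < card T. (1 / c) ^ card T * real (card (containing H S T))) \<le> ?\<epsilon>1 * (fact n / 2)"
      unfolding weight .
  qed (use finM finH SM c01 q2 \<epsilon> in \<open>simp_all del: of_nat_mult\<close>)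
  then have cover: "fragment_cover M H S (fact n) (card M) p (?\<epsilon>3 + ?\<epsilon>2 + ?\<epsilon>1)" unfolding q3 by simp
  have "subset_expectation M p (\<lambda>W. of_bool (\<not> (\<exists>i\<in>H. S i \<subseteq> W))) \<le> ?\<epsilon>3 + ?\<epsilon>2 + ?\<epsilon>1"
    using cover[unfolded fragment_cover_def, rule_format, of H S] cardH card_mono[OF finM SM] by auto
  moreover have p0: "0 \<le> p" using p c01 unfolding c_def by linarith
  have "1 - subset_expectation M p (\<lambda>W. of_bool (W \<in> {E. contains_square_hamilton_cycle {1..n} E})) \<le>
      subset_expectation M p (\<lambda>W. of_bool (\<not> (\<exists>i\<in>H. S i \<subseteq> W)))"
  proof -
    have "subset_expectation M p (\<lambda>_. 1) \<le> subset_expectation M p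
       (\<lambda>W. of_bool (\<not> (\<exists>i\<in>H. S i \<subseteq> W)) + of_bool (W \<in> {E. contains_square_hamilton_cycle {1..n} E}))"
    proof (rule subset_expectation_mono[OF p0 p(2)])
      fix W
      show "1 \<le> of_bool (\<not> (\<exists>i\<in>H. S i \<subseteq> W)) + (of_bool (W \<in> {E. contains_square_hamilton_cycle {1..n} E}) :: real)"
        using contains_square_hamilton_cycleI[of n _ W] n by (auto simp: H_def S_def)
    qed
    then show ?thesis by (simp only: subset_expectation_add subset_expectation_const[OF finM])
  qed
  ultimately show ?thesis
    using prob_binomial_random_graph[OF p0 p(2)] unfolding M_def by simp
qed

section \<open>Asymptotics of the error terms\<close>

lemma one_plus_power_le_exp:
  fixes x :: real
  assumes "0 \<le> x" "real k * x \<le> y"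
  shows "(1 + x) ^ k \<le> exp y"
proof -
  have "(1 + x) ^ k \<le> exp x ^ k"
    using assms exp_ge_add_one_self[of x] by (intro power_mono) auto
  also have "\<dots> = exp (real k * x)" by (simp add: exp_of_nat_mult)
  also have "\<dots> \<le> exp y" using assms by simp
  finally show ?thesis .
qed

lemma quarter_power_le_exp:
  assumes "x - 1 \<le> real m"
  shows "(1 / 4) ^ m \<le> exp (1 - x)"
proof -
  have "exp (1::real) \<le> 4" using exp_le by linarith
  then have "(1 / 4 :: real) \<le> exp (- 1)" by (simp add: exp_minus field_simps)
  then have "(1 / 4 :: real) ^ m \<le> exp (- 1) ^ m" by (rule power_mono) simp
  also have "\<dots> = exp (real m * (- 1))" by (simp only: exp_of_nat_mult)
  also have "\<dots> \<le> exp (1 - x)" using assms by simp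
  finally show ?thesis .
qed

theorem theorem1p1:
  shows "\<exists>K::real. \<forall>p::nat \<Rightarrow> real.
           (\<forall>n. 0 \<le> p n \<and> p n \<le> 1) \<longrightarrow>
           (\<forall>\<^sub>F n in sequentially. p n \<ge> K / sqrt (real n)) \<longrightarrow>
           (\<lambda>n. measure_pmf.prob (binomial_random_graph n (p n))
                  {E. contains_square_hamilton_cycle {1..n} E}) \<longlonglongrightarrow> 1"
proof (intro exI[of _ "3 * density_const"] allI impI)
  \<comment> \<open>The factor 3 in the witness pays for three rounds of density
    \<open>density_const / sqrt n\<close>.\<close>
  fix p :: "nat \<Rightarrow> real"
  assume p01: "\<forall>n. 0 \<le> p n \<and> p n \<le> 1"
    and p: "\<forall>\<^sub>F n in sequentially. p n \<ge> 3 * density_const / sqrt (real n)"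
  define P where "P n = measure_pmf.prob (binomial_random_graph n (p n))
                  {E. contains_square_hamilton_cycle {1..n} E}" for n
  \<comment> \<open>The error bound with the floor functions eliminated, so that
    \<open>real_asymp\<close> applies.\<close>
  define D :: "nat \<Rightarrow> real" where "D n =
    16 * sqrt n ^ 3 * (exp (1 - sqrt n) * exp (sqrt n / 2)) +
    4 * (exp (1 - sqrt (sqrt n)) * exp ((4 * sqrt n + 6) / (2 * sqrt n))) +
    8 * (exp (4 * sqrt (sqrt n) / (8 * sqrt n)) - 1)" for n
  have "D \<longlonglongrightarrow> 0" unfolding D_def by real_asymp
  then have lim: "(\<lambda>n. 1 - D n) \<longlonglongrightarrow> 1"
    using tendsto_diff[OF tendsto_const[of 1]] by fastforce
  have small: "(\<lambda>n. density_const / sqrt (real n)) \<longlonglongrightarrow> 0" by real_asymp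
  have "\<forall>\<^sub>F n in sequentially. density_const / sqrt (real n) < 1"
    using order_tendstoD(2)[OF small, of 1] by simp
  moreover have "\<forall>\<^sub>F n::nat in sequentially. 8 * sqrt n + 12 < n" by real_asymp
  moreover have "\<forall>\<^sub>F n::nat in sequentially. 8 * sqrt (sqrt n) < n" by real_asymp
  ultimately have "\<forall>\<^sub>F n in sequentially. 1 - D n \<le> P n"
    using p eventually_ge_at_top[of 5]
  proof eventually_elim
    case (elim n)
    \<comment> \<open>With \<open>m1\<close> near \<open>sqrt n\<close>, the first error term decays
      like \<open>exp (- sqrt n / 2)\<close> up to a polynomial factor. With \<open>m2\<close> near
      the fourth root of \<open>n\<close>, \<open>m2\<close> tends to infinity and
      \<open>m2 / sqrt n\<close> to 0, as the second and third terms require.\<close>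
    define m1 where "m1 = nat \<lfloor>sqrt n\<rfloor>"
    define m2 where "m2 = nat \<lfloor>sqrt (sqrt n)\<rfloor>"
    have m1: "sqrt n - 1 \<le> real m1" "real m1 \<le> sqrt n" unfolding m1_def using real_sqrt_ge_zero[of "real n"] by linarith+
    have m2: "sqrt (sqrt n) - 1 \<le> real m2" "real m2 \<le> sqrt (sqrt n)"
      unfolding m2_def using real_sqrt_ge_zero[OF real_sqrt_ge_zero[of "real n"]] by linarith+
    have rn: "sqrt n > 0" using elim by simp
    have "real (4 * (2 * m1 + 3)) < real n" using m1 elim by simp
    then have c1: "4 * (2 * m1 + 3) < n" by (simp only: of_nat_less_iff)
    have "real (8 * m2) < real n" using m2 elim by simp
    then have c2: "8 * m2 < n" by (simp only: of_nat_less_iff)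
    have sq: "real n = sqrt n * sqrt n" by simp
    have "1 - P n \<le>
      16 * sqrt n ^ 3 * ((1 / 4) ^ m1 * (1 + 1 / (2 * sqrt n)) ^ n) +
      4 * ((1 / 4) ^ m2 * (1 + 1 / (2 * sqrt n)) ^ (2 * (2 * m1 + 3))) +
      8 * ((1 + 1 / (8 * sqrt n)) ^ (2 * (2 * m2)) - 1)"
      unfolding P_def using elim p01 c1 c2 by (intro prob_no_square_hamilton_cycle_le) auto
    also have "\<dots> \<le> D n"
      unfolding D_def
    proof (intro add_mono mult_left_mono diff_right_mono mult_mono quarter_power_le_exp one_plus_power_le_exp)
      show "real n * (1 / (2 * sqrt n)) \<le> sqrt n / 2"
        using rn by (subst sq) (simp add: field_simps)
      show "real (2 * (2 * m1 + 3)) * (1 / (2 * sqrt n)) \<le> (4 * sqrt n + 6) / (2 * sqrt n)"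
        using m1 rn by (simp add: field_simps)
      show "real (2 * (2 * m2)) * (1 / (8 * sqrt n)) \<le> 4 * sqrt (sqrt n) / (8 * sqrt n)"
        using m2 rn by (simp add: field_simps)
    qed (use m1 m2 in auto)
    finally show ?case by simp
  qed
  moreover have "\<forall>\<^sub>F n in sequentially. P n \<le> 1" unfolding P_def by simp
  ultimately have "P \<longlonglongrightarrow> 1" using lim tendsto_const by (rule tendsto_sandwich)
  then show "(\<lambda>n. measure_pmf.prob (binomial_random_graph n (p n))
                  {E. contains_square_hamilton_cycle {1..n} E}) \<longlonglongrightarrow> 1"
    unfolding P_def .
qed

end
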